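(* Fix an integer $t\ge1$, let $\beta^\star\in(1/2,1]$, $T^\star>0$ and $\alpha\in(0,1)$. For each $K$ put $\delta^\star=\sqrt{2(1/T^\star)\ln K}$, $\varepsilon^\star=K^{-\beta^\star}$, $\mathbf{P}^\star=\mathbf{P}_{\varepsilon^\star,\delta^\star}$, and for integers $s\ge1$ let $$E^\star_s=\prod_{i=1}^K\left\{(1-\varepsilon^\star)+\varepsilon^\star\frac{p_{\delta^\star}(X_{i,1},\dots,X_{i,s})}{p_0(X_{i,1},\dots,X_{i,s})}\right\},\qquad \tau^\star=\inf\{s\ge1:E^\star_s\ge1/\alpha\}.$$ Let $t^\star=T^\star\rho(\beta^\star)$. Then, as $K\to\infty$, $$\mathbf{P}^\star\{\tau^\star\le t\}\to\begin{cases}0&\text{if } t<t^\star,\\ 1&\text{if } t>t^\star.\end{cases}$$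
   Context: Model: for $K\in\mathbf{N}$, $\varepsilon\in[0,1]$, $\delta>0$, $\mathbf{P}_{\varepsilon,\delta}$ is the law of an array $(X_{i,s})_{1\le i\le K,\,s\ge1}$ generated as follows: $A_1,\dots,A_K$ are i.i.d. Bernoulli$(\varepsilon)$ (latent), and conditionally on $(A_i)$ the $X_{i,s}$ are independent with $X_{i,s}\sim\mathrm{Normal}(\delta A_i,1)$. $p_\delta(x_1,\dots,x_s)=\prod_{u\le s}\frac{1}{\sqrt{2\pi}}e^{-(x_u-\delta)^2/2}$. Detection boundary: $\rho(\beta)=\beta-\frac12$ for $\beta\in(1/2,3/4)$ and $\rho(\beta)=(1-\sqrt{1-\beta})^2$ for $\beta\in[3/4,1]$.
   Formalization: The limit 1 for t > t* is asserted only for β* < 1: at β* = 1 it is false, since with probability tending to 1/e all A_i vanish and then τ* ≤ t has probability at most α; the limit 0 for t < t* is kept for all β* in (1/2,1]. *)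

theory Defs
  imports "HOL-Probability.Probability"
begin

text \<open>
  Outcomes are arrays \<open>\<omega> :: nat \<times> nat \<Rightarrow> real\<close>; the observation \<open>X\<^bsub>i,s\<^esub>\<close> is the coordinate \<open>\<omega> (i, s)\<close>,
  for \<open>i \<in> {1..K}\<close> and \<open>s \<in> {1..}\<close>.  The latent \<open>A\<^sub>i\<close> are the truth values of a Bernoulli vector.
\<close>

definition array_law_given :: "nat \<Rightarrow> real \<Rightarrow> (nat \<Rightarrow> bool) \<Rightarrow> (nat \<times> nat \<Rightarrow> real) measure" where
  "array_law_given K \<delta> A =
     (\<Pi>\<^sub>M (i, s) \<in> {1..K} \<times> {1..}. density lborel (normal_density (\<delta> * of_bool (A i)) 1))"

definition array_law :: "nat \<Rightarrow> real \<Rightarrow> real \<Rightarrow> (nat \<times> nat \<Rightarrow> real) measure" where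
  "array_law K \<epsilon> \<delta> =
     measure_pmf (Pi_pmf {1..K} False (\<lambda>_. bernoulli_pmf \<epsilon>)) \<bind> array_law_given K \<delta>"

text \<open>The joint density \<open>p\<^sub>\<delta>(x\<^sub>1, \<dots>, x\<^sub>s)\<close>; only the values \<open>x u\<close> with \<open>u \<in> {1..s}\<close> matter.\<close>

definition gauss_dens :: "real \<Rightarrow> nat \<Rightarrow> (nat \<Rightarrow> real) \<Rightarrow> real" where
  "gauss_dens \<delta> s x = (\<Prod>u\<in>{1..s}. 1 / sqrt (2 * pi) * exp (- (x u - \<delta>)\<^sup>2 / 2))"

definition e_proc :: "nat \<Rightarrow> real \<Rightarrow> real \<Rightarrow> nat \<Rightarrow> (nat \<times> nat \<Rightarrow> real) \<Rightarrow> real" where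
  "e_proc K \<epsilon> \<delta> s \<omega> =
     (\<Prod>i\<in>{1..K}. (1 - \<epsilon>) +
        \<epsilon> * (gauss_dens \<delta> s (\<lambda>u. \<omega> (i, u)) / gauss_dens 0 s (\<lambda>u. \<omega> (i, u))))"

text \<open>The infimum is taken in \<^typ>\<open>enat\<close>, so that it is \<open>\<infinity>\<close> if the threshold is never reached.\<close>

definition stop_time :: "nat \<Rightarrow> real \<Rightarrow> real \<Rightarrow> real \<Rightarrow> (nat \<times> nat \<Rightarrow> real) \<Rightarrow> enat" where
  "stop_time K \<epsilon> \<delta> \<alpha> \<omega> = (INF s\<in>{s. 1 \<le> s \<and> 1 / \<alpha> \<le> e_proc K \<epsilon> \<delta> s \<omega>}. enat s)"

text \<open>
  Meant for \<open>\<beta> \<in> {1/2<..1}\<close>.  At the endpoint \<open>\<beta> = 1\<close> the conclusion ``probability tends to 1 above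
  the boundary'' is false, and is therefore only to be asserted for \<open>\<beta> < 1\<close>: with \<open>\<epsilon> = 1 / K\<close>,
  all the \<open>A\<^sub>i\<close> vanish with probability \<open>(1 - 1 / K)\<^sup>K \<longlonglongrightarrow> exp (-1)\<close>, and in that case the threshold
  \<open>1 / \<alpha>\<close> is ever reached with probability at most \<open>\<alpha>\<close> (Ville's inequality).  So for every \<open>t\<close> the
  limit superior of the detection probability is at most \<open>1 - (1 - \<alpha>) * exp (-1) < 1\<close>.
\<close>

definition detection_boundary :: "real \<Rightarrow> real" where
  "detection_boundary \<beta> = (if \<beta> < 3 / 4 then \<beta> - 1 / 2 else (1 - sqrt (1 - \<beta>))\<^sup>2)"

definition delta_star :: "real \<Rightarrow> nat \<Rightarrow> real" where
  "delta_star T K = sqrt (2 * (1 / T) * ln (real K))"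

definition eps_star :: "real \<Rightarrow> nat \<Rightarrow> real" where
  "eps_star \<beta> K = real K powr (- \<beta>)"

definition detect_prob :: "real \<Rightarrow> real \<Rightarrow> real \<Rightarrow> nat \<Rightarrow> nat \<Rightarrow> real" where
  "detect_prob \<beta> T \<alpha> t K =
     \<P>(\<omega> in array_law K (eps_star \<beta> K) (delta_star T K).
         stop_time K (eps_star \<beta> K) (delta_star T K) \<alpha> \<omega> \<le> enat t)"

end

theory Submission
  imports Defs "HOL-Real_Asymp.Real_Asymp"
begin

text \<open>
  The process \<open>E\<^sub>s\<close> is the likelihood ratio of the observed rows under \<open>P\<^sup>*\<close> against the pure noise law \<open>P\<^sub>0\<close>.
  It depends on the row statistics \<open>W\<^sub>i = (X\<^bsub>i,1\<^esub> + \<dots> + X\<^bsub>i,s\<^esub>) / sqrt s\<close> only, which are i.i.d. mixtures of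
  \<open>N(0, 1)\<close> and \<open>N(\<mu>, 1)\<close>, where \<open>\<mu> = sqrt s * \<delta>\<^sup>* = sqrt (2 (s / T) ln K)\<close>.  Let \<open>A\<close> be the Hellinger affinity
  of this mixture and \<open>N(0, 1)\<close>.  Since the \<open>P\<^sub>0\<close>-expectation of \<open>sqrt E\<^sub>s\<close> is \<open>A\<^sup>K\<close>,
  for \<open>c > 1\<close> the bounds \<open>E \<le> (sqrt c / (sqrt c - 1))\<^sup>2 (sqrt E - 1)\<^sup>2\<close> on \<open>{E \<ge> c}\<close> and
  \<open>E \<le> sqrt c sqrt E\<close> on \<open>{E < c}\<close> give
  \<open>P\<^sup>*(E\<^sub>s \<ge> c) = O(K (1 - A))\<close> and \<open>P\<^sup>*(E\<^sub>s < c) \<le> sqrt c exp (- K (1 - A))\<close>.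
  Everything thus reduces to showing that \<open>K (1 - A)\<close> tends to \<open>0\<close> if \<open>s / T < \<rho>(\<beta>)\<close>
  and to infinity if \<open>s / T > \<rho>(\<beta>)\<close> and \<open>\<beta> < 1\<close>.
\<close>

subsection \<open>Product laws and row statistics\<close>

text \<open>Both sides are determined by their values on rectangles. There the indicator is a
  product over coordinates, so Fubini splits the integral into the one-dimensional ones.\<close>

lemma density_PiM:
  assumes I: "finite I" and M: "\<And>i. prob_space (M i)"
    and f [measurable]: "\<And>i. f i \<in> borel_measurable (M i)"
    and p: "\<And>i. prob_space (density (M i) (f i))"
  shows "density (PiM I M) (\<lambda>x. \<Prod>i\<in>I. f i (x i)) = PiM I (\<lambda>i. density (M i) (f i))"
proof (rule product_sigma_finite.PiM_eqI)
  interpret product_sigma_finite M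
    using M by (simp add: product_sigma_finite_def prob_space_imp_sigma_finite)
  show "product_sigma_finite (\<lambda>i. density (M i) (f i))"
    using p by (simp add: product_sigma_finite_def prob_space_imp_sigma_finite)
  show "finite I" by fact
  show "sets (density (PiM I M) (\<lambda>x. \<Prod>i\<in>I. f i (x i))) = sets (PiM I (\<lambda>i. density (M i) (f i)))"
    by (simp cong: sets_PiM_cong)
  fix A assume "\<And>i. i \<in> I \<Longrightarrow> A i \<in> sets (density (M i) (f i))"
  then have A [measurable]: "\<And>i. i \<in> I \<Longrightarrow> A i \<in> sets (M i)" by simp
  have "emeasure (density (PiM I M) (\<lambda>x. \<Prod>i\<in>I. f i (x i))) (Pi\<^sub>E I A)
      = (\<integral>\<^sup>+x. (\<Prod>i\<in>I. f i (x i)) * indicator (Pi\<^sub>E I A) x \<partial>PiM I M)"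
    using I by (subst emeasure_density) (auto intro!: sets_PiM_I_finite)
  also have "\<dots> = (\<integral>\<^sup>+x. (\<Prod>i\<in>I. f i (x i) * indicator (A i) (x i)) \<partial>PiM I M)"
  proof (rule nn_integral_cong)
    fix x assume "x \<in> space (PiM I M)"
    then have "indicator (Pi\<^sub>E I A) x = (\<Prod>i\<in>I. indicator (A i) (x i) :: ennreal)"
      using I by (auto simp: indicator_def space_PiM PiE_iff)
    then show "(\<Prod>i\<in>I. f i (x i)) * indicator (Pi\<^sub>E I A) x = (\<Prod>i\<in>I. f i (x i) * indicator (A i) (x i))"
      by (simp add: prod.distrib)
  qed
  also have "\<dots> = (\<Prod>i\<in>I. \<integral>\<^sup>+x. f i x * indicator (A i) x \<partial>M i)"
    using I by (intro product_nn_integral_prod) auto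
  also have "\<dots> = (\<Prod>i\<in>I. emeasure (density (M i) (f i)) (A i))"
    by (intro prod.cong refl) (simp add: emeasure_density)
  finally show "emeasure (density (PiM I M) (\<lambda>x. \<Prod>i\<in>I. f i (x i))) (Pi\<^sub>E I A)
      = (\<Prod>i\<in>I. emeasure (density (M i) (f i)) (A i))" .
qed

text \<open>This integrates out the latent labels row by row: on a rectangle the conditional
  probability is a product of functions of one label each, and the labels are independent under
  \<open>Pi_pmf\<close>. The common measurable space \<open>S\<close> is what makes \<open>N\<close>
  a kernel.\<close>

lemma bind_Pi_pmf_PiM:
  fixes N :: "'b \<Rightarrow> 'c measure"
  assumes I: "finite I" and N: "\<And>b. prob_space (N b)" and S: "\<And>b. sets (N b) = sets S"
  shows "measure_pmf (Pi_pmf I d p) \<bind> (\<lambda>A. PiM I (\<lambda>i. N (A i))) = PiM I (\<lambda>i. measure_pmf (p i) \<bind> N)"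
proof (rule product_sigma_finite.PiM_eqI)
  have N': "N b \<in> space (subprob_algebra S)" for b
    using N S by (simp add: space_subprob_algebra prob_space_imp_subprob_space)
  have PN: "PiM I (\<lambda>i. N (A i)) \<in> space (subprob_algebra (PiM I (\<lambda>_. S)))" for A
    using N S by (auto simp: space_subprob_algebra intro!: prob_space_imp_subprob_space prob_space_PiM
      sets_PiM_cong)
  have sN: "sets (measure_pmf q \<bind> N) = sets S" for q
    using N' by (intro sets_bind) (auto simp: S)
  show "product_sigma_finite (\<lambda>i. measure_pmf (p i) \<bind> N)"
    unfolding product_sigma_finite_def
    using N N' by (auto intro!: prob_space_imp_sigma_finite measure_pmf.prob_space_bind)
  show "finite I" by fact
  show "sets (measure_pmf (Pi_pmf I d p) \<bind> (\<lambda>A. PiM I (\<lambda>i. N (A i)))) =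
      sets (PiM I (\<lambda>i. measure_pmf (p i) \<bind> N))"
    using PN by (subst sets_bind[where N="PiM I (\<lambda>_. S)"]) (auto simp: S sN intro!: sets_PiM_cong)
  fix B assume B: "\<And>i. i \<in> I \<Longrightarrow> B i \<in> sets (measure_pmf (p i) \<bind> N)"
  have "emeasure (measure_pmf (Pi_pmf I d p) \<bind> (\<lambda>A. PiM I (\<lambda>i. N (A i)))) (Pi\<^sub>E I B)
      = (\<integral>\<^sup>+A. emeasure (PiM I (\<lambda>i. N (A i))) (Pi\<^sub>E I B) \<partial>measure_pmf (Pi_pmf I d p))"
    using PN B I by (intro emeasure_bind[where N="PiM I (\<lambda>_. S)"]) (auto simp: sN intro!: sets_PiM_I_finite)
  also have "\<dots> = (\<integral>\<^sup>+A. (\<Prod>i\<in>I. emeasure (N (A i)) (B i)) \<partial>measure_pmf (Pi_pmf I d p))"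
  proof (rule nn_integral_cong)
    fix A :: "'a \<Rightarrow> 'b"
    interpret product_sigma_finite "\<lambda>i. N (A i)"
      using N by (simp add: product_sigma_finite_def prob_space_imp_sigma_finite)
    show "emeasure (PiM I (\<lambda>i. N (A i))) (Pi\<^sub>E I B) = (\<Prod>i\<in>I. emeasure (N (A i)) (B i))"
      using B I by (intro emeasure_PiM) (auto simp: sN S)
  qed
  also have "\<dots> = (\<Prod>i\<in>I. \<integral>\<^sup>+b. emeasure (N b) (B i) \<partial>measure_pmf (p i))"
    by (rule nn_integral_prod_Pi_pmf[OF I])
  also have "\<dots> = (\<Prod>i\<in>I. emeasure (measure_pmf (p i) \<bind> N) (B i))"
    using B N' by (intro prod.cong refl emeasure_bind[symmetric, where N=S]) (auto simp: sN)
  finally show "emeasure (measure_pmf (Pi_pmf I d p) \<bind> (\<lambda>A. PiM I (\<lambda>i. N (A i)))) (Pi\<^sub>E I B)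
      = (\<Prod>i\<in>I. emeasure (measure_pmf (p i) \<bind> N) (B i))" .
qed

text \<open>The joint map of all coordinates is the identity on the product space, so the joint law
  is the product of its own marginals. The set \<open>I\<close> may be infinite, as it is for the
  array with its infinitely many columns.\<close>

lemma indep_vars_PiM_coordinate:
  assumes "\<And>i. i \<in> I \<Longrightarrow> prob_space (M i)" and "I \<noteq> {}"
  shows "prob_space.indep_vars (PiM I M) M (\<lambda>i \<omega>. \<omega> i) I"
proof -
  interpret prob_space "PiM I M"
    using assms(1) by (rule prob_space_PiM)
  have "distr (PiM I M) (PiM I M) (\<lambda>x. \<lambda>i\<in>I. x i) = distr (PiM I M) (PiM I M) (\<lambda>x. x)"
    by (intro distr_cong) (auto simp: space_PiM PiE_restrict)
  also have "\<dots> = PiM I (\<lambda>i. distr (PiM I M) (M i) (\<lambda>x. x i))"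
    by (auto simp: assms(1) distr_PiM_component intro!: PiM_cong)
  finally show ?thesis
    using assms(2) by (subst indep_vars_iff_distr_eq_PiM') auto
qed

section \<open>Law of the rescaled row sums\<close>

definition row_stat :: "nat \<Rightarrow> nat \<Rightarrow> (nat \<times> nat \<Rightarrow> real) \<Rightarrow> nat \<Rightarrow> real" where
  "row_stat K s \<omega> = (\<lambda>i\<in>{1..K}. (\<Sum>u\<in>{1..s}. \<omega> (i, u)) / sqrt (real s))"

lemma prob_space_normal: "prob_space (density lborel (normal_density m 1))"
  by (rule prob_space_normal_density) simp

lemma sets_array_law_given:
  "sets (array_law_given K \<delta> A) = sets (PiM ({1..K} \<times> {1..}) (\<lambda>_. borel))"
  unfolding array_law_given_def by (intro sets_PiM_cong) auto

lemma prob_space_array_law_given: "prob_space (array_law_given K \<delta> A)"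
  unfolding array_law_given_def by (intro prob_space_PiM) (auto intro: prob_space_normal)

lemma measurable_row_stat [measurable]:
  "row_stat K s \<in> PiM ({1..K} \<times> {1..}) (\<lambda>_. borel) \<rightarrow>\<^sub>M PiM {1..K} (\<lambda>_. borel)"
  unfolding row_stat_def
  by (intro measurable_restrict borel_measurable_divide borel_measurable_sum measurable_component_singleton
      borel_measurable_const) auto

text \<open>Given the labels, a row sum over s columns is normal with variance s and mean s times
  the row mean. Dividing by sqrt s gives unit variance, so that the noise law is the same for every
  s. Rows are independent because they use disjoint blocks of coordinates.\<close>

lemma distr_row_stat_given:
  assumes K: "1 \<le> K" and s: "1 \<le> s"
  shows "distr (array_law_given K \<delta> A) (PiM {1..K} (\<lambda>_. borel)) (row_stat K s)
       = PiM {1..K} (\<lambda>i. density lborel (normal_density (sqrt (real s) * \<delta> * of_bool (A i)) 1))"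
proof -
  let ?I = "{1..K} \<times> {1..} :: (nat \<times> nat) set"
  define M where "M = (\<lambda>j. density lborel (normal_density (\<delta> * of_bool (A (fst (j :: nat \<times> nat)))) 1))"
  have eq: "array_law_given K \<delta> A = PiM ?I M"
    by (simp add: array_law_given_def M_def case_prod_unfold)
  interpret prob_space "PiM ?I M"
    by (intro prob_space_PiM) (auto simp: M_def intro: prob_space_normal)
  have "indep_vars M (\<lambda>j \<omega>. \<omega> j) ?I"
    using K by (intro indep_vars_PiM_coordinate) (auto simp: M_def intro: prob_space_normal)
  from indep_vars_compose2[OF this, where Y="\<lambda>_ x. x" and N="\<lambda>_. borel"]
  have ind: "indep_vars (\<lambda>_. borel) (\<lambda>j \<omega>. \<omega> j) ?I"
    by (auto simp: M_def)
  have normal: "distributed (PiM ?I M) lborel (\<lambda>\<omega>. \<omega> j) (normal_density (\<delta> * of_bool (A (fst j))) 1)"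
    if "j \<in> ?I" for j
  proof -
    have "distr (PiM ?I M) (M j) (\<lambda>\<omega>. \<omega> j) = M j"
      using that by (intro distr_PiM_component) (auto simp: M_def intro: prob_space_normal)
    also have "distr (PiM ?I M) (M j) (\<lambda>\<omega>. \<omega> j) = distr (PiM ?I M) lborel (\<lambda>\<omega>. \<omega> j)"
      by (intro distr_cong) (auto simp: M_def)
    finally have d: "distr (PiM ?I M) lborel (\<lambda>\<omega>. \<omega> j) = density lborel (normal_density (\<delta> * of_bool (A (fst j))) 1)"
      by (simp add: M_def)
    have "(\<lambda>\<omega>. \<omega> j) \<in> PiM ?I M \<rightarrow>\<^sub>M M j"
      using that by measurable
    then have "(\<lambda>\<omega>. \<omega> j) \<in> PiM ?I M \<rightarrow>\<^sub>M lborel"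
      by (simp add: M_def)
    then show ?thesis using d by (auto simp: distributed_def)
  qed
  have W: "distributed (PiM ?I M) lborel (\<lambda>\<omega>. row_stat K s \<omega> i)
      (normal_density (sqrt (real s) * \<delta> * of_bool (A i)) 1)" if i: "i \<in> {1..K}" for i
  proof -
    \<comment> \<open>Singleton blocks turn independence over pairs into independence over the
      columns of row \<open>i\<close>.\<close>
    have "indep_vars (\<lambda>_. borel) (\<lambda>u \<omega>. \<omega> (i, u)) {1..s}"
    proof -
      have "indep_vars (\<lambda>u. PiM {(i, u)} (\<lambda>_. borel)) (\<lambda>u \<omega>. restrict (\<lambda>j. \<omega> j) {(i, u)}) {1..s}"
        by (rule indep_vars_restrict[OF ind]) (use i in \<open>auto simp: disjoint_family_on_def\<close>)
      from indep_vars_compose2[OF this, where Y="\<lambda>u x. x (i, u)" and N="\<lambda>_. borel"]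
      show ?thesis
        by (auto intro!: measurable_component_singleton)
    qed
    then have "distributed (PiM ?I M) lborel (\<lambda>\<omega>. \<Sum>u\<in>{1..s}. \<omega> (i, u))
       (normal_density (\<Sum>u\<in>{1..s}. \<delta> * of_bool (A i)) (sqrt (\<Sum>u\<in>{1..s}. 1\<^sup>2)))"
      using s i normal[of "(i, _)"] by (intro sum_indep_normal) auto
    then have "distributed (PiM ?I M) lborel (\<lambda>\<omega>. \<Sum>u\<in>{1..s}. \<omega> (i, u))
       (normal_density (real s * (\<delta> * of_bool (A i))) (sqrt (real s)))"
      by simp
    from normal_density_affine[OF this, of "1 / sqrt (real s)" 0]
    have "distributed (PiM ?I M) lborel (\<lambda>\<omega>. (\<Sum>u\<in>{1..s}. \<omega> (i, u)) / sqrt (real s))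
       (normal_density (real s * (\<delta> * of_bool (A i)) / sqrt (real s)) 1)"
      using s by simp
    moreover have "real s * (\<delta> * of_bool (A i)) / sqrt (real s) = real s / sqrt (real s) * (\<delta> * of_bool (A i))"
      by simp
    then have "real s * (\<delta> * of_bool (A i)) / sqrt (real s) = sqrt (real s) * \<delta> * of_bool (A i)"
      by (simp only: real_div_sqrt[OF of_nat_0_le_iff] mult.assoc)
    ultimately show ?thesis using i by (simp add: row_stat_def)
  qed
  \<comment> \<open>Across rows, the blocks are the sets \<open>{i} \<times> {1..s}\<close>, and
    each statistic is a function of its own block.\<close>
  have "indep_vars (\<lambda>_. borel) (\<lambda>i \<omega>. row_stat K s \<omega> i) {1..K}"
  proof -
    have "indep_vars (\<lambda>i. PiM ({i} \<times> {1..s}) (\<lambda>_. borel)) (\<lambda>i \<omega>. restrict (\<lambda>j. \<omega> j) ({i} \<times> {1..s})) {1..K}"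
      by (rule indep_vars_restrict[OF ind]) (auto simp: disjoint_family_on_def)
    from indep_vars_compose2[OF this, where Y="\<lambda>i x. (\<Sum>u\<in>{1..s}. x (i, u)) / sqrt (real s)" and N="\<lambda>_. borel"]
    have "indep_vars (\<lambda>_. borel) (\<lambda>i \<omega>. (\<Sum>u\<in>{1..s}. restrict (\<lambda>j. \<omega> j) ({i} \<times> {1..s}) (i, u)) / sqrt (real s)) {1..K}"
      by (auto intro!: borel_measurable_sum measurable_component_singleton)
    then show ?thesis
      by (rule iffD1[OF indep_vars_cong, rotated -1]) (auto simp: row_stat_def)
  qed
  then have "distr (PiM ?I M) (PiM {1..K} (\<lambda>_. borel)) (\<lambda>\<omega>. \<lambda>i\<in>{1..K}. row_stat K s \<omega> i)
     = PiM {1..K} (\<lambda>i. distr (PiM ?I M) borel (\<lambda>\<omega>. row_stat K s \<omega> i))"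
    using K W by (subst (asm) indep_vars_iff_distr_eq_PiM') (auto simp: distributed_def)
  also have "\<dots> = PiM {1..K} (\<lambda>i. density lborel (normal_density (sqrt (real s) * \<delta> * of_bool (A i)) 1))"
  proof (rule PiM_cong)
    fix i assume "i \<in> {1..K}"
    have "distr (PiM ?I M) borel (\<lambda>\<omega>. row_stat K s \<omega> i) = distr (PiM ?I M) lborel (\<lambda>\<omega>. row_stat K s \<omega> i)"
      by (intro distr_cong) auto
    also have "\<dots> = density lborel (normal_density (sqrt (real s) * \<delta> * of_bool (A i)) 1)"
      using W[OF \<open>i \<in> {1..K}\<close>] by (simp add: distributed_def)
    finally show "distr (PiM ?I M) borel (\<lambda>\<omega>. row_stat K s \<omega> i) = \<dots>" .
  qed simp
  also have "(\<lambda>\<omega>. \<lambda>i\<in>{1..K}. row_stat K s \<omega> i) = row_stat K s"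
    by (auto simp: row_stat_def fun_eq_iff)
  finally show ?thesis by (simp add: eq)
qed

section \<open>Likelihood ratio of a normal mixture against the noise law\<close>

definition lr_mix :: "real \<Rightarrow> real \<Rightarrow> real \<Rightarrow> real" where
  "lr_mix \<epsilon> \<mu> z = 1 - \<epsilon> + \<epsilon> * exp (\<mu> * z - \<mu>\<^sup>2 / 2)"

abbreviation std_normal :: "real measure" where
  "std_normal \<equiv> density lborel std_normal_density"

lemma measurable_lr_mix [measurable]: "lr_mix \<epsilon> \<mu> \<in> borel_measurable borel"
  unfolding lr_mix_def by measurable

lemma lr_mix_nonneg: "0 \<le> \<epsilon> \<Longrightarrow> \<epsilon> \<le> 1 \<Longrightarrow> 0 \<le> lr_mix \<epsilon> \<mu> z"
  by (simp add: lr_mix_def)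

lemma normal_density_shift: "normal_density \<mu> 1 z = std_normal_density z * exp (\<mu> * z - \<mu>\<^sup>2 / 2)"
  by (simp add: normal_density_def power2_eq_square field_simps flip: exp_add)

text \<open>A shift of the normal law is an exponential tilt of its density, so the two components
  share the base measure \<open>std_normal\<close> and their weights can be collected in a single
  density.\<close>

lemma bernoulli_bind_normal:
  assumes "0 \<le> \<epsilon>" "\<epsilon> \<le> 1"
  shows "measure_pmf (bernoulli_pmf \<epsilon>) \<bind> (\<lambda>b. density lborel (normal_density (\<mu> * of_bool b) 1))
       = density std_normal (lr_mix \<epsilon> \<mu>)"
proof (rule measure_eqI)
  have N: "density lborel (normal_density m 1) \<in> space (subprob_algebra borel)" for m
    using prob_space_normal by (simp add: space_subprob_algebra prob_space_imp_subprob_space)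
  show "sets (measure_pmf (bernoulli_pmf \<epsilon>) \<bind> (\<lambda>b. density lborel (normal_density (\<mu> * of_bool b) 1)))
      = sets (density std_normal (lr_mix \<epsilon> \<mu>))"
    using N by (subst sets_bind[where N=borel]) auto
  fix X assume "X \<in> sets (measure_pmf (bernoulli_pmf \<epsilon>) \<bind> (\<lambda>b. density lborel (normal_density (\<mu> * of_bool b) 1)))"
  then have X [measurable]: "X \<in> sets borel"
    using N by (subst (asm) sets_bind[where N=borel]) auto
  have "emeasure (measure_pmf (bernoulli_pmf \<epsilon>) \<bind> (\<lambda>b. density lborel (normal_density (\<mu> * of_bool b) 1))) X
      = (\<integral>\<^sup>+b. emeasure (density lborel (normal_density (\<mu> * of_bool b) 1)) X \<partial>measure_pmf (bernoulli_pmf \<epsilon>))"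
    using N X by (intro emeasure_bind[where N=borel]) auto
  also have "\<dots> = \<epsilon> * emeasure (density lborel (normal_density \<mu> 1)) X + (1 - \<epsilon>) * emeasure std_normal X"
    using assms by (simp add: mult.commute)
  also have "\<dots> = (\<integral>\<^sup>+z. ennreal \<epsilon> * (ennreal (normal_density \<mu> 1 z) * indicator X z)
      + ennreal (1 - \<epsilon>) * (ennreal (std_normal_density z) * indicator X z) \<partial>lborel)"
    by (simp add: emeasure_density nn_integral_add nn_integral_cmult)
  also have "\<dots> = (\<integral>\<^sup>+z. ennreal (std_normal_density z) * ennreal (lr_mix \<epsilon> \<mu> z) * indicator X z \<partial>lborel)"
  proof (rule nn_integral_cong)
    fix z
    have "ennreal \<epsilon> * ennreal (normal_density \<mu> 1 z) + ennreal (1 - \<epsilon>) * ennreal (std_normal_density z)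
        = ennreal (\<epsilon> * normal_density \<mu> 1 z + (1 - \<epsilon>) * std_normal_density z)"
      using assms by (subst ennreal_plus) (auto simp: ennreal_mult)
    also have "\<epsilon> * normal_density \<mu> 1 z + (1 - \<epsilon>) * std_normal_density z = std_normal_density z * lr_mix \<epsilon> \<mu> z"
      unfolding normal_density_shift[of \<mu>] lr_mix_def by (simp add: algebra_simps)
    also have "ennreal \<dots> = ennreal (std_normal_density z) * ennreal (lr_mix \<epsilon> \<mu> z)"
      using assms by (intro ennreal_mult lr_mix_nonneg) auto
    finally show "ennreal \<epsilon> * (ennreal (normal_density \<mu> 1 z) * indicator X z)
        + ennreal (1 - \<epsilon>) * (ennreal (std_normal_density z) * indicator X z)
        = ennreal (std_normal_density z) * ennreal (lr_mix \<epsilon> \<mu> z) * indicator X z"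
      by (simp add: indicator_def)
  qed
  also have "\<dots> = emeasure (density std_normal (lr_mix \<epsilon> \<mu>)) X"
    by (simp add: density_density_eq emeasure_density)
  finally show "emeasure (measure_pmf (bernoulli_pmf \<epsilon>) \<bind> (\<lambda>b. density lborel (normal_density (\<mu> * of_bool b) 1))) X
     = emeasure (density std_normal (lr_mix \<epsilon> \<mu>)) X" .
qed

lemma prob_space_lr_mix:
  assumes "0 \<le> \<epsilon>" "\<epsilon> \<le> 1"
  shows "prob_space (density std_normal (lr_mix \<epsilon> \<mu>))"
  unfolding bernoulli_bind_normal[OF assms, symmetric]
  using prob_space_normal
  by (intro measure_pmf.prob_space_bind[where S=borel])
     (auto simp: space_subprob_algebra prob_space_imp_subprob_space)

lemma array_law_given_measurable:
  "array_law_given K \<delta> \<in> measure_pmf p \<rightarrow>\<^sub>M subprob_algebra (PiM ({1..K} \<times> {1..}) (\<lambda>_. borel))"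
  using prob_space_array_law_given sets_array_law_given
  by (auto simp: space_subprob_algebra prob_space_imp_subprob_space)

lemma sets_array_law: "sets (array_law K \<epsilon> \<delta>) = sets (PiM ({1..K} \<times> {1..}) (\<lambda>_. borel))"
  unfolding array_law_def by (intro sets_bind) (auto simp: sets_array_law_given)

lemma prob_space_array_law: "prob_space (array_law K \<epsilon> \<delta>)"
  unfolding array_law_def
  by (rule measure_pmf.prob_space_bind[OF _ array_law_given_measurable]) (simp add: prob_space_array_law_given)

text \<open>Conditioning on the labels, then integrating them out, gives i.i.d. mixtures; their
  densities multiply. The resulting density against pure noise is the process at time
  \<open>s\<close>, which makes the change of measure possible.\<close>

lemma distr_row_stat:
  assumes "1 \<le> K" "1 \<le> s" "0 \<le> \<epsilon>" "\<epsilon> \<le> 1"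
  shows "distr (array_law K \<epsilon> \<delta>) (PiM {1..K} (\<lambda>_. borel)) (row_stat K s)
       = density (PiM {1..K} (\<lambda>_. std_normal)) (\<lambda>w. \<Prod>i\<in>{1..K}. ennreal (lr_mix \<epsilon> (sqrt (real s) * \<delta>) (w i)))"
proof -
  let ?p = "Pi_pmf {1..K} False (\<lambda>_. bernoulli_pmf \<epsilon>)" and ?\<mu> = "sqrt (real s) * \<delta>"
  have "distr (array_law K \<epsilon> \<delta>) (PiM {1..K} (\<lambda>_. borel)) (row_stat K s)
      = measure_pmf ?p \<bind> (\<lambda>A. distr (array_law_given K \<delta> A) (PiM {1..K} (\<lambda>_. borel)) (row_stat K s))"
    unfolding array_law_def by (rule distr_bind[OF array_law_given_measurable _ measurable_row_stat]) simp
  also have "\<dots> = measure_pmf ?p \<bind> (\<lambda>A. PiM {1..K} (\<lambda>i. density lborel (normal_density (?\<mu> * of_bool (A i)) 1)))"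
    by (simp only: distr_row_stat_given[OF assms(1,2)])
  also have "\<dots> = PiM {1..K} (\<lambda>_. measure_pmf (bernoulli_pmf \<epsilon>) \<bind> (\<lambda>b. density lborel (normal_density (?\<mu> * of_bool b) 1)))"
    by (rule bind_Pi_pmf_PiM[where S=borel]) (auto intro: prob_space_normal)
  also have "\<dots> = PiM {1..K} (\<lambda>_. density std_normal (lr_mix \<epsilon> ?\<mu>))"
    using assms by (simp add: bernoulli_bind_normal)
  also have "\<dots> = density (PiM {1..K} (\<lambda>_. std_normal)) (\<lambda>w. \<Prod>i\<in>{1..K}. ennreal (lr_mix \<epsilon> ?\<mu> (w i)))"
    using assms by (intro density_PiM[symmetric] prob_space_lr_mix prob_space_normal) auto
  finally show ?thesis .
qed

section \<open>The process as a function of the row statistics\<close>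

lemma gauss_dens_ratio:
  assumes "1 \<le> s"
  shows "gauss_dens \<delta> s x / gauss_dens 0 s x
       = exp (sqrt (real s) * \<delta> * ((\<Sum>u\<in>{1..s}. x u) / sqrt (real s)) - (sqrt (real s) * \<delta>)\<^sup>2 / 2)"
proof -
  \<comment> \<open>The normalizing constants and the squares of the observations cancel, which
    leaves only the row sum.\<close>
  have "gauss_dens \<delta> s x / gauss_dens 0 s x = (\<Prod>u\<in>{1..s}. exp (\<delta> * x u - \<delta>\<^sup>2 / 2))"
    unfolding gauss_dens_def
    by (simp flip: prod_dividef exp_diff) (auto intro!: prod.cong simp: power2_eq_square field_simps)
  also have "\<dots> = exp (\<delta> * (\<Sum>u\<in>{1..s}. x u) - real s * \<delta>\<^sup>2 / 2)"
    by (simp add: sum_subtractf sum_distrib_left flip: exp_sum)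
  finally show ?thesis using assms by (simp add: power_mult_distrib mult.assoc)
qed

lemma e_proc_row_stat:
  assumes "1 \<le> s"
  shows "e_proc K \<epsilon> \<delta> s \<omega> = (\<Prod>i\<in>{1..K}. lr_mix \<epsilon> (sqrt (real s) * \<delta>) (row_stat K s \<omega> i))"
  unfolding e_proc_def gauss_dens_ratio[OF assms] lr_mix_def by (simp add: row_stat_def)

subsection \<open>Hellinger affinity and product likelihood ratios\<close>

text \<open>Since \<open>density M a\<close> has total mass 1, \<open>a\<close> is integrable with
  integral 1; its root is dominated by \<open>1 + a\<close>.\<close>

lemma
  fixes a :: "'a \<Rightarrow> real"
  assumes M: "prob_space M" and a [measurable]: "a \<in> borel_measurable M"
    and a_nonneg: "\<And>x. 0 \<le> a x" and pa: "prob_space (density M a)"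
  shows integrable_sqrt_density: "integrable M (\<lambda>x. sqrt (a x))"
  and integrable_density: "integrable M a" and integral_density_1: "(\<integral>x. a x \<partial>M) = 1"
proof -
  interpret prob_space M by (fact M)
  have "(\<integral>\<^sup>+x. a x \<partial>M) = emeasure (density M a) (space (density M a))"
    by (auto simp: emeasure_density intro!: nn_integral_cong)
  also have "\<dots> = 1" by (rule prob_space.emeasure_space_1[OF pa])
  finally have 1: "(\<integral>\<^sup>+x. a x \<partial>M) = 1" .
  then show i: "integrable M a"
    using a_nonneg by (intro integrableI_nn_integral_finite[where x=1]) auto
  show "(\<integral>x. a x \<partial>M) = 1"
    using 1 a_nonneg by (simp add: integral_eq_nn_integral)
  have "sqrt (a x) \<le> 1 + a x" for x
    using a_nonneg[of x] by (intro real_le_lsqrt) (auto simp: power2_eq_square algebra_simps)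
  then have "AE x in M. norm (sqrt (a x)) \<le> norm (1 + a x)"
    using a_nonneg by (intro AE_I2) (simp add: add_nonneg_nonneg)
  moreover have "integrable M (\<lambda>x. 1 + a x)"
    by (intro Bochner_Integration.integrable_add integrable_const i)
  moreover have "(\<lambda>x. sqrt (a x)) \<in> borel_measurable M"
    by measurable
  ultimately show "integrable M (\<lambda>x. sqrt (a x))"
    by (rule Bochner_Integration.integrable_bound[rotated 2])
qed

text \<open>Expand the square and use that \<open>a\<close> has integral 1. The right-hand side is
  the unnormalized squared Hellinger distance between \<open>M\<close> and
  \<open>density M a\<close>.\<close>

lemma integral_sqrt_density:
  fixes a :: "'a \<Rightarrow> real"
  assumes M: "prob_space M" and a: "a \<in> borel_measurable M" "\<And>x. 0 \<le> a x" "prob_space (density M a)"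
  shows "2 * (1 - (\<integral>x. sqrt (a x) \<partial>M)) = (\<integral>x. (sqrt (a x) - 1)\<^sup>2 \<partial>M)"
    and "integrable M (\<lambda>x. (sqrt (a x) - 1)\<^sup>2)"
proof -
  interpret prob_space M by fact
  have eq: "(sqrt (a x) - 1)\<^sup>2 = a x - 2 * sqrt (a x) + 1" for x
    using a(2)[of x] by (simp add: power2_diff)
  note i = integrable_sqrt_density[OF assms] integrable_density[OF assms]
  have int: "integrable M (\<lambda>x. a x - 2 * sqrt (a x))"
    by (intro Bochner_Integration.integrable_diff integrable_mult_right i)
  then show "integrable M (\<lambda>x. (sqrt (a x) - 1)\<^sup>2)"
    unfolding eq by (intro Bochner_Integration.integrable_add integrable_const)
  have "(\<integral>x. (sqrt (a x) - 1)\<^sup>2 \<partial>M) = (\<integral>x. a x - 2 * sqrt (a x) \<partial>M) + 1"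
    unfolding eq using prob_space by (subst Bochner_Integration.integral_add[OF int integrable_const]) simp
  also have "(\<integral>x. a x - 2 * sqrt (a x) \<partial>M) = 1 - 2 * (\<integral>x. sqrt (a x) \<partial>M)"
    using i integral_density_1[OF assms]
    by (subst Bochner_Integration.integral_diff) auto
  finally show "2 * (1 - (\<integral>x. sqrt (a x) \<partial>M)) = (\<integral>x. (sqrt (a x) - 1)\<^sup>2 \<partial>M)" by simp
qed

context
  fixes M :: "'a measure" and a :: "'a \<Rightarrow> real" and I :: "'i set"
  assumes M: "prob_space M" and a [measurable]: "a \<in> borel_measurable M"
    and a_nonneg: "\<And>x. 0 \<le> a x" and pa: "prob_space (density M a)" and I: "finite I"
begin

private lemmas density_facts =
  integrable_sqrt_density[OF M a a_nonneg pa] integrable_density[OF M a a_nonneg pa] integral_density_1[OF M a a_nonneg pa]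

text \<open>In the application \<open>Q\<close> is the noise law of all row statistics,
  \<open>P\<close> their law under the mixture, \<open>E\<close> the likelihood ratio between the
  two and \<open>aff\<close> the affinity of a single row.\<close>

private abbreviation (input) "Q \<equiv> PiM I (\<lambda>_. M)"
private abbreviation (input) "E \<equiv> \<lambda>x. \<Prod>i\<in>I. a (x i)"
private abbreviation (input) "P \<equiv> density Q (\<lambda>x. \<Prod>i\<in>I. ennreal (a (x i)))"
private abbreviation (input) "aff \<equiv> (\<integral>x. sqrt (a x) \<partial>M)"

private lemma E_nonneg: "0 \<le> E x"
  by (intro prod_nonneg a_nonneg)

private lemma sqrt_E: "sqrt (E x) = (\<Prod>i\<in>I. sqrt (a (x i)))"
  using I by (induction rule: finite_induct) (simp_all add: real_sqrt_mult)

private lemma product_integrals: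
  shows "integrable Q E" "(\<integral>x. E x \<partial>Q) = 1"
    "integrable Q (\<lambda>x. sqrt (E x))" "(\<integral>x. sqrt (E x) \<partial>Q) = aff ^ card I"
proof -
  interpret product_sigma_finite "\<lambda>_. M"
    using M by (simp add: product_sigma_finite_def prob_space_imp_sigma_finite)
  note P = product_integrable_prod[OF I, where f="\<lambda>_. a", OF density_facts(2)]
    product_integral_prod[OF I, where f="\<lambda>_. a", OF density_facts(2)]
    product_integrable_prod[OF I, where f="\<lambda>_ x. sqrt (a x)", OF density_facts(1)]
    product_integral_prod[OF I, where f="\<lambda>_ x. sqrt (a x)", OF density_facts(1)]
  show "integrable Q E"
    by (rule P(1))
  show "(\<integral>x. E x \<partial>Q) = 1"
    unfolding P(2) density_facts(3) by simp
  show "integrable Q (\<lambda>x. sqrt (E x))"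
    unfolding sqrt_E by (rule P(3))
  show "(\<integral>x. sqrt (E x) \<partial>Q) = aff ^ card I"
    unfolding sqrt_E P(4) by simp
qed

private lemma measure_P:
  assumes S: "S \<in> sets Q"
  shows "measure P S = (\<integral>x. E x * indicator S x \<partial>Q)" "integrable Q (\<lambda>x. E x * indicator S x)"
proof -
  have [measurable]: "E \<in> borel_measurable Q" by measurable
  have P: "P = density Q (\<lambda>x. ennreal (E x))"
    using a_nonneg by (simp add: prod_ennreal)
  have "measure P S = (\<integral>x. indicator S x \<partial>P)"
    using S by simp
  also have "\<dots> = (\<integral>x. E x * indicator S x \<partial>Q)"
    unfolding P using S E_nonneg by (subst integral_real_density) auto
  finally show "measure P S = (\<integral>x. E x * indicator S x \<partial>Q)" .
  show "integrable Q (\<lambda>x. E x * indicator S x)"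
    using integrable_mult_indicator[OF S product_integrals(1)] by (simp add: mult.commute)
qed

text \<open>Change the measure to \<open>Q\<close> and write \<open>E\<close> as the square of its
  root: on the event one of the two factors is below sqrt c, and the other integrates to a power of
  the affinity.\<close>

lemma prob_product_density_less:
  assumes c: "0 < c"
  shows "measure P {x \<in> space Q. E x < c} \<le> sqrt c * aff ^ card I"
proof -
  let ?S = "{x \<in> space Q. E x < c}"
  have S: "?S \<in> sets Q" by measurable
  have "E x * indicator ?S x \<le> sqrt c * sqrt (E x)" for x
  proof -
    have "sqrt (E x) * sqrt (E x) \<le> sqrt c * sqrt (E x)" if "E x < c"
      using that E_nonneg[of x] by (intro mult_right_mono) auto
    then show ?thesis using E_nonneg[of x] c by (auto simp: indicator_def)
  qed
  then have "(\<integral>x. E x * indicator ?S x \<partial>Q) \<le> (\<integral>x. sqrt c * sqrt (E x) \<partial>Q)"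
    by (intro integral_mono measure_P(2)[OF S] integrable_mult_right product_integrals)
  then show ?thesis by (simp add: measure_P(1)[OF S] product_integrals)
qed

text \<open>On the event \<open>E\<close> is well above 1, hence bounded by a multiple of (sqrt E -
  1)^2. The integral of the latter under \<open>Q\<close> is the squared Hellinger distance of the
  product laws.\<close>

lemma prob_product_density_ge:
  assumes c: "1 < c"
  shows "measure P {x \<in> space Q. c \<le> E x} \<le> (sqrt c / (sqrt c - 1))\<^sup>2 * (2 - 2 * aff ^ card I)"
proof -
  let ?S = "{x \<in> space Q. c \<le> E x}" and ?C = "sqrt c / (sqrt c - 1)"
  interpret Q: prob_space Q using M by (intro prob_space_PiM)
  have S: "?S \<in> sets Q" by measurable
  have "E x * indicator ?S x \<le> ?C\<^sup>2 * (E x - 2 * sqrt (E x) + 1)" for x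
  proof -
    have sq: "E x - 2 * sqrt (E x) + 1 = (sqrt (E x) - 1)\<^sup>2"
      using E_nonneg[of x] by (simp add: power2_diff)
    show ?thesis
    proof (cases "c \<le> E x")
      case True
      have r: "sqrt c \<le> sqrt (E x)" "1 < sqrt c" using True c by auto
      \<comment> \<open>The map u / (u - 1) is decreasing for u > 1, and \<open>?C\<close> is its
        value at sqrt c.\<close>
      then have "sqrt (E x) \<le> ?C * (sqrt (E x) - 1)"
        by (simp add: field_simps)
      then have "(sqrt (E x))\<^sup>2 \<le> (?C * (sqrt (E x) - 1))\<^sup>2"
        using E_nonneg[of x] by (intro power_mono) auto
      then have "E x \<le> ?C\<^sup>2 * (sqrt (E x) - 1)\<^sup>2"
        by (simp only: power_mult_distrib real_sqrt_pow2[OF E_nonneg])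
      then show ?thesis unfolding sq by (simp add: indicator_def)
    qed (simp add: sq indicator_def)
  qed
  moreover have int: "integrable Q (\<lambda>x. E x - 2 * sqrt (E x))"
    by (intro Bochner_Integration.integrable_diff integrable_mult_right product_integrals)
  moreover have "integrable Q (\<lambda>x. ?C\<^sup>2 * (E x - 2 * sqrt (E x) + 1))"
    by (intro integrable_mult_right Bochner_Integration.integrable_add int Q.integrable_const)
  ultimately have "(\<integral>x. E x * indicator ?S x \<partial>Q) \<le> (\<integral>x. ?C\<^sup>2 * (E x - 2 * sqrt (E x) + 1) \<partial>Q)"
    by (intro integral_mono measure_P(2)[OF S])
  also have "\<dots> = ?C\<^sup>2 * ((\<integral>x. E x - 2 * sqrt (E x) \<partial>Q) + (\<integral>x. (1::real) \<partial>Q))"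
    by (simp only: integral_mult_right_zero Bochner_Integration.integral_add[OF int Q.integrable_const])
  also have "(\<integral>x. E x - 2 * sqrt (E x) \<partial>Q) = (\<integral>x. E x \<partial>Q) - (\<integral>x. 2 * sqrt (E x) \<partial>Q)"
    by (intro Bochner_Integration.integral_diff integrable_mult_right product_integrals)
  also have "\<dots> = 1 - 2 * aff ^ card I"
    by (simp only: integral_mult_right_zero product_integrals)
  also have "(\<integral>x. (1::real) \<partial>Q) = 1"
    by (simp add: Q.prob_space)
  also have "1 - 2 * aff ^ card I + 1 = 2 - 2 * aff ^ card I"
    by simp
  finally show ?thesis by (simp only: measure_P(1)[OF S])
qed

end

subsection \<open>Gaussian mixtures\<close>

definition affinity :: "real \<Rightarrow> real \<Rightarrow> real" where
  "affinity \<epsilon> \<mu> = (\<integral>z. sqrt (lr_mix \<epsilon> \<mu> z) \<partial>std_normal)"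

text \<open>The Gaussian moment generating function. The additive constant stays inside the
  exponential so that the dominating functions below match the left-hand side directly.\<close>

lemma std_normal_exp:
  "integrable std_normal (\<lambda>z. exp (b * z + c))"
  "(\<integral>z. exp (b * z + c) \<partial>std_normal) = exp (b\<^sup>2 / 2 + c)"
proof -
  have eq: "std_normal_density z * exp (b * z + c) = normal_density b 1 z * exp (b\<^sup>2 / 2 + c)" for z
    unfolding normal_density_shift[of b] by (simp add: mult.assoc flip: exp_add)
  show "integrable std_normal (\<lambda>z. exp (b * z + c))"
    by (subst integrable_real_density) (auto simp: eq)
  show "(\<integral>z. exp (b * z + c) \<partial>std_normal) = exp (b\<^sup>2 / 2 + c)"
    by (subst integral_real_density) (auto simp: eq)
qed

text \<open>In a - 1 = (sqrt a - 1)(sqrt a + 1) the second factor is at least 1 and at least |sqrt a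
  - 1|. The quadratic bound is the good one near a = 1, the linear one for large a.\<close>

lemma sqrt_minus_1_sq_le:
  assumes "0 \<le> (a::real)"
  shows "(sqrt a - 1)\<^sup>2 \<le> (a - 1)\<^sup>2" "(sqrt a - 1)\<^sup>2 \<le> \<bar>a - 1\<bar>"
proof -
  have a: "a - 1 = (sqrt a - 1) * (sqrt a + 1)"
    using assms by (simp add: algebra_simps)
  have "\<bar>sqrt a - 1\<bar> * 1 \<le> \<bar>sqrt a - 1\<bar> * (sqrt a + 1)"
    using real_sqrt_ge_zero[OF assms] by (intro mult_left_mono abs_leI) simp_all
  then have "\<bar>sqrt a - 1\<bar> \<le> \<bar>a - 1\<bar>"
    unfolding a abs_mult using assms by simp
  then show "(sqrt a - 1)\<^sup>2 \<le> (a - 1)\<^sup>2"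
    by (simp add: abs_le_square_iff)
  have "\<bar>sqrt a - 1\<bar> * \<bar>sqrt a - 1\<bar> \<le> \<bar>sqrt a - 1\<bar> * (sqrt a + 1)"
    using real_sqrt_ge_zero[OF assms] by (intro mult_left_mono abs_leI) simp_all
  then show "(sqrt a - 1)\<^sup>2 \<le> \<bar>a - 1\<bar>"
    unfolding a abs_mult using assms by (simp add: power2_eq_square flip: abs_mult)
qed

text \<open>With w = sqrt (1 + y) - 1 one has y = w (w + 2). If w <= 1 then y <= 3 w, and if w > 1
  then y <= 9 w^2, so the factor 9 serves both ranges.\<close>

lemma min_sq_le_sqrt_minus_1_sq:
  assumes "0 \<le> (y::real)"
  shows "min y (y\<^sup>2) / 9 \<le> (sqrt (1 + y) - 1)\<^sup>2"
proof -
  define w where "w = sqrt (1 + y) - 1"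
  have w: "0 \<le> w" "y = w * (w + 2)"
    using assms by (auto simp: w_def algebra_simps)
  show ?thesis
  proof (cases "w \<le> 1")
    case True
    have "y\<^sup>2 \<le> (w * 3)\<^sup>2"
      unfolding w(2) using w(1) True by (intro power_mono mult_left_mono) auto
    then show ?thesis by (simp add: power_mult_distrib flip: w_def)
  next
    case False
    have "w * (w + 2) \<le> w * (9 * w)"
      using False by (intro mult_left_mono) auto
    then show ?thesis unfolding w_def[symmetric] using w(2) by (simp add: power2_eq_square)
  qed
qed

text \<open>The integrand is split at \<open>h\<close>, and the indicator of each part is dominated by an exponential.\<close>

lemma affinity_ge:
  assumes \<epsilon>: "0 \<le> \<epsilon>" "\<epsilon> \<le> 1" and l: "0 \<le> l\<^sub>0" "0 \<le> l\<^sub>1" "0 \<le> l\<^sub>2"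
  shows "2 * (1 - affinity \<epsilon> \<mu>) \<le> \<epsilon>\<^sup>2 * (1 + exp ((2 * \<mu> - l\<^sub>0)\<^sup>2 / 2 + (l\<^sub>0 * h - \<mu>\<^sup>2)))
     + \<epsilon> * (exp ((\<mu> + l\<^sub>1)\<^sup>2 / 2 + (- l\<^sub>1 * h - \<mu>\<^sup>2 / 2)) + exp (l\<^sub>2\<^sup>2 / 2 + (- l\<^sub>2 * h)))"
proof -
  interpret prob_space std_normal by (rule prob_space_normal)
  note hyp = prob_space_normal _ lr_mix_nonneg[OF \<epsilon>] prob_space_lr_mix[OF \<epsilon>]
  let ?g = "\<lambda>z. \<epsilon>\<^sup>2 * (1 + exp ((2 * \<mu> - l\<^sub>0) * z + (l\<^sub>0 * h - \<mu>\<^sup>2)))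
     + \<epsilon> * (exp ((\<mu> + l\<^sub>1) * z + (- l\<^sub>1 * h - \<mu>\<^sup>2 / 2)) + exp (l\<^sub>2 * z + (- l\<^sub>2 * h)))"
  have "(sqrt (lr_mix \<epsilon> \<mu> z) - 1)\<^sup>2 \<le> ?g z" for z
  proof -
    define L where "L = exp (\<mu> * z - \<mu>\<^sup>2 / 2)"
    have L: "0 \<le> L" by (simp add: L_def)
    have a: "lr_mix \<epsilon> \<mu> z - 1 = \<epsilon> * (L - 1)"
      by (simp add: lr_mix_def L_def algebra_simps)
    \<comment> \<open>The quadratic bound is used for z <= h and the linear one for z > h.\<close>
    note sq = sqrt_minus_1_sq_le[OF lr_mix_nonneg[OF \<epsilon>, of \<mu> z], unfolded a]
    show ?thesis
    proof (cases "z \<le> h")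
      case True
      have "(L - 1)\<^sup>2 \<le> 1 + L\<^sup>2 * 1"
        using L by (simp add: power2_diff)
      also have "\<dots> \<le> 1 + L\<^sup>2 * exp (l\<^sub>0 * (h - z))"
        using True l by (intro add_left_mono mult_left_mono) auto
      also have "L\<^sup>2 * exp (l\<^sub>0 * (h - z)) = exp ((2 * \<mu> - l\<^sub>0) * z + (l\<^sub>0 * h - \<mu>\<^sup>2))"
        by (simp add: L_def algebra_simps flip: exp_add exp_double)
      finally have "\<epsilon>\<^sup>2 * (L - 1)\<^sup>2 \<le> \<epsilon>\<^sup>2 * (1 + exp ((2 * \<mu> - l\<^sub>0) * z + (l\<^sub>0 * h - \<mu>\<^sup>2)))"
        by (intro mult_left_mono) auto
      moreover have "0 \<le> \<epsilon> * (exp ((\<mu> + l\<^sub>1) * z + (- l\<^sub>1 * h - \<mu>\<^sup>2 / 2)) + exp (l\<^sub>2 * z + (- l\<^sub>2 * h)))"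
        using \<epsilon> by (intro mult_nonneg_nonneg add_nonneg_nonneg) auto
      ultimately show ?thesis using sq(1) by (simp add: power_mult_distrib)
    next
      case False
      have "\<bar>L - 1\<bar> \<le> L * 1 + 1"
        using L by simp
      \<comment> \<open>The signal term and the constant 1 get parameters of their own, because the
        best exponents for the two differ.\<close>
      also have "\<dots> \<le> L * exp (l\<^sub>1 * (z - h)) + exp (l\<^sub>2 * (z - h))"
        using False l L by (intro add_mono mult_left_mono) auto
      also have "L * exp (l\<^sub>1 * (z - h)) = exp ((\<mu> + l\<^sub>1) * z + (- l\<^sub>1 * h - \<mu>\<^sup>2 / 2))"
        by (simp add: L_def algebra_simps flip: exp_add)
      also have "exp (l\<^sub>2 * (z - h)) = exp (l\<^sub>2 * z + (- l\<^sub>2 * h))"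
        by (simp add: algebra_simps)
      finally have "\<epsilon> * \<bar>L - 1\<bar> \<le> \<epsilon> * (exp ((\<mu> + l\<^sub>1) * z + (- l\<^sub>1 * h - \<mu>\<^sup>2 / 2)) + exp (l\<^sub>2 * z + (- l\<^sub>2 * h)))"
        using \<epsilon> by (intro mult_left_mono) auto
      moreover have "0 \<le> \<epsilon>\<^sup>2 * (1 + exp ((2 * \<mu> - l\<^sub>0) * z + (l\<^sub>0 * h - \<mu>\<^sup>2)))"
        by (intro mult_nonneg_nonneg add_nonneg_nonneg) auto
      moreover have "\<bar>\<epsilon> * (L - 1)\<bar> = \<epsilon> * \<bar>L - 1\<bar>"
        using \<epsilon> by (simp add: abs_mult)
      ultimately show ?thesis using sq(2) by linarith
    qed
  qed
  moreover have one: "(\<integral>z. (1::real) \<partial>std_normal) = 1"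
    using prob_space by simp
  moreover have "integrable std_normal ?g"
    by (intro Bochner_Integration.integrable_add integrable_mult_right integrable_const std_normal_exp)
  moreover have "integrable std_normal (\<lambda>z. (sqrt (lr_mix \<epsilon> \<mu> z) - 1)\<^sup>2)"
    by (rule integral_sqrt_density(2)[OF hyp]) simp
  ultimately have "(\<integral>z. (sqrt (lr_mix \<epsilon> \<mu> z) - 1)\<^sup>2 \<partial>std_normal) \<le> (\<integral>z. ?g z \<partial>std_normal)"
    by (intro integral_mono)
  also have "(\<integral>z. (sqrt (lr_mix \<epsilon> \<mu> z) - 1)\<^sup>2 \<partial>std_normal) = 2 * (1 - affinity \<epsilon> \<mu>)"
    unfolding affinity_def by (rule integral_sqrt_density(1)[OF hyp, symmetric]) simp
  also have "(\<integral>z. ?g z \<partial>std_normal) = \<epsilon>\<^sup>2 * (1 + exp ((2 * \<mu> - l\<^sub>0)\<^sup>2 / 2 + (l\<^sub>0 * h - \<mu>\<^sup>2)))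
     + \<epsilon> * (exp ((\<mu> + l\<^sub>1)\<^sup>2 / 2 + (- l\<^sub>1 * h - \<mu>\<^sup>2 / 2)) + exp (l\<^sub>2\<^sup>2 / 2 + (- l\<^sub>2 * h)))"
    by (simp only: Bochner_Integration.integral_add Bochner_Integration.integrable_add integrable_mult_right
        integrable_const integral_mult_right_zero std_normal_exp one)
  finally show ?thesis .
qed

text \<open>Only the part of the Hellinger integral over [h, h + 1] is kept. There the likelihood
  ratio is at least its value at h, hence at least 1 + y, and the normal density is at least its
  value at h + 1.\<close>

lemma affinity_le:
  assumes \<epsilon>: "0 \<le> \<epsilon>" "\<epsilon> \<le> 1" and "0 \<le> \<mu>" and h: "0 \<le> h" and y: "0 \<le> y" "y \<le> \<epsilon> * (exp (\<mu> * h - \<mu>\<^sup>2 / 2) - 1)"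
  shows "min y (y\<^sup>2) / 9 * std_normal_density (h + 1) \<le> 2 * (1 - affinity \<epsilon> \<mu>)"
proof -
  note hyp = prob_space_normal _ lr_mix_nonneg[OF \<epsilon>] prob_space_lr_mix[OF \<epsilon>]
  have i: "integrable std_normal (\<lambda>z. (sqrt (lr_mix \<epsilon> \<mu> z) - 1)\<^sup>2)"
    by (rule integral_sqrt_density(2)[OF hyp]) simp
  have i': "integrable lborel (\<lambda>z. std_normal_density z * (sqrt (lr_mix \<epsilon> \<mu> z) - 1)\<^sup>2)"
    using i by (subst (asm) integrable_real_density) auto
  let ?c = "min y (y\<^sup>2) / 9 * std_normal_density (h + 1)"
  have le: "?c * indicator {h..h+1} z \<le> std_normal_density z * (sqrt (lr_mix \<epsilon> \<mu> z) - 1)\<^sup>2" for z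
  proof (cases "z \<in> {h..h+1}")
    case True
    have "z\<^sup>2 \<le> (h + 1)\<^sup>2"
      using True h by (intro power_mono) auto
    then have 1: "std_normal_density (h + 1) \<le> std_normal_density z"
      by (auto simp: std_normal_density_def divide_right_mono)
    have "\<mu> * h \<le> \<mu> * z"
      using True \<open>0 \<le> \<mu>\<close> by (intro mult_left_mono) auto
    then have "exp (\<mu> * h - \<mu>\<^sup>2 / 2) \<le> exp (\<mu> * z - \<mu>\<^sup>2 / 2)"
      by simp
    then have "\<epsilon> * (exp (\<mu> * h - \<mu>\<^sup>2 / 2) - 1) \<le> \<epsilon> * (exp (\<mu> * z - \<mu>\<^sup>2 / 2) - 1)"
      using \<epsilon> by (intro mult_left_mono) auto
    with y have "1 + y \<le> lr_mix \<epsilon> \<mu> z"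
      by (simp add: lr_mix_def algebra_simps)
    then have "sqrt (1 + y) - 1 \<le> sqrt (lr_mix \<epsilon> \<mu> z) - 1"
      by simp
    then have "(sqrt (1 + y) - 1)\<^sup>2 \<le> (sqrt (lr_mix \<epsilon> \<mu> z) - 1)\<^sup>2"
      using y(1) by (intro power_mono) auto
    with min_sq_le_sqrt_minus_1_sq[OF y(1)]
    have "min y (y\<^sup>2) / 9 \<le> (sqrt (lr_mix \<epsilon> \<mu> z) - 1)\<^sup>2"
      by (rule order_trans)
    then have "min y (y\<^sup>2) / 9 * std_normal_density (h + 1) \<le> (sqrt (lr_mix \<epsilon> \<mu> z) - 1)\<^sup>2 * std_normal_density z"
      using 1 by (intro mult_mono) auto
    then show ?thesis using True by (simp add: mult.commute)
  qed simp
  \<comment> \<open>The window has length 1.\<close>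
  have "?c = (\<integral>z. ?c * indicator {h..h+1} z \<partial>lborel)"
    by simp
  also have "\<dots> \<le> (\<integral>z. std_normal_density z * (sqrt (lr_mix \<epsilon> \<mu> z) - 1)\<^sup>2 \<partial>lborel)"
    using le i' by (intro integral_mono) (auto intro!: integrable_mult_right)
  also have "\<dots> = (\<integral>z. (sqrt (lr_mix \<epsilon> \<mu> z) - 1)\<^sup>2 \<partial>std_normal)"
    by (subst integral_real_density) auto
  also have "\<dots> = 2 * (1 - affinity \<epsilon> \<mu>)"
    unfolding affinity_def by (rule integral_sqrt_density(1)[OF hyp, symmetric]) simp
  finally show ?thesis .
qed

subsection \<open>The detection boundary\<close>

text \<open>With u = sqrt (1 - \<beta>), the two branches differ by 2 (u - 1/2)^2, so they touch at
  \<beta> = 3/4.\<close>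

lemma detection_boundary_le:
  assumes "1 / 2 < \<beta>" "\<beta> \<le> 1"
  shows "detection_boundary \<beta> \<le> (1 - sqrt (1 - \<beta>))\<^sup>2"
proof -
  define u where "u = sqrt (1 - \<beta>)"
  have u: "\<beta> = 1 - u\<^sup>2"
    using assms by (simp add: u_def)
  have "0 \<le> 2 * (u - 1 / 2)\<^sup>2" by simp
  then have "\<beta> - 1 / 2 \<le> (1 - u)\<^sup>2"
    unfolding u power2_eq_square by (simp add: algebra_simps)
  then show ?thesis by (simp add: detection_boundary_def u_def)
qed

text \<open>The last two expressions are exponents of K in the upper bound for the Hellinger
  distance: the signal term beyond the cut, and the second moment of the likelihood ratio before it.
  The maximum is the best exponential parameter for the latter.\<close>

lemma below_boundary:
  assumes \<beta>: "1 / 2 < \<beta>" "\<beta> \<le> 1" and \<rho>: "0 \<le> \<rho>" "\<rho>\<^sup>2 < detection_boundary \<beta>"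
  shows "\<rho> < 1" "2 * \<rho> - \<rho>\<^sup>2 - \<beta> < 0"
    and "1 - 2 * \<beta> + (2 * \<rho> - max 0 (2 * \<rho> - 1))\<^sup>2 - 2 * \<rho>\<^sup>2 + 2 * max 0 (2 * \<rho> - 1) < 0"
proof -
  define u where "u = sqrt (1 - \<beta>)"
  have u: "\<beta> = 1 - u\<^sup>2" "0 \<le> u" "u < 1"
    using \<beta> by (auto simp: u_def)
  have "\<rho>\<^sup>2 < (1 - u)\<^sup>2"
    using \<rho>(2) detection_boundary_le[OF \<beta>] by (simp add: u_def)
  then have \<rho>u: "\<rho> < 1 - u"
    using u by (intro power2_less_imp_less[of \<rho> "1 - u"]) auto
  then show "\<rho> < 1" using u by simp
  have "u\<^sup>2 < (1 - \<rho>)\<^sup>2"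
    using \<rho>u u by (intro power_strict_mono) auto
  then show *: "2 * \<rho> - \<rho>\<^sup>2 - \<beta> < 0"
    unfolding u(1) by (simp add: power2_diff)
  show "1 - 2 * \<beta> + (2 * \<rho> - max 0 (2 * \<rho> - 1))\<^sup>2 - 2 * \<rho>\<^sup>2 + 2 * max 0 (2 * \<rho> - 1) < 0"
  \<comment> \<open>For \<rho> <= 1/2 the maximum is 0 and the expression is 1 - 2 \<beta> + 2
    \<rho>^2. Otherwise it is twice the exponent already shown to be negative.\<close>
  proof (cases "\<rho> \<le> 1 / 2")
    case True
    have "\<rho>\<^sup>2 < \<beta> - 1 / 2"
    proof (cases "\<beta> \<le> 3 / 4")
      case True
      \<comment> \<open>At \<beta> = 3/4 the definition takes its second branch, whose value there
        agrees with the first.\<close>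
      have half: "sqrt (1 - 3 / 4) = 1 / 2"
        by (rule real_sqrt_unique) (auto simp: power2_eq_square)
      have quarter: "detection_boundary (3 / 4) = 1 / 4"
        unfolding detection_boundary_def half by (simp add: power2_eq_square)
      from True have "detection_boundary \<beta> = \<beta> - 1 / 2"
      proof (cases "\<beta> = 3 / 4")
        case eq: True
        show ?thesis unfolding eq using quarter by linarith
      qed (simp add: detection_boundary_def)
      with \<rho> show ?thesis by simp
    next
      case False
      have "\<rho>\<^sup>2 \<le> (1 / 2)\<^sup>2"
        using True \<rho> by (intro power_mono) auto
      with False show ?thesis by (simp add: power2_eq_square)
    qed
    with True show ?thesis by (simp add: power2_eq_square)
  next
    case False
    then have "max 0 (2 * \<rho> - 1) = 2 * \<rho> - 1" by simp
    then show ?thesis using * by simp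
  qed
qed

text \<open>The Hellinger distance will be bounded below by its part over \<open>{h..h + 1}\<close> with \<open>h = \<theta> sqrt (2 ln K)\<close>.  With
  \<open>\<mu> = \<rho> sqrt (2 ln K)\<close>, the signal term of the mixture likelihood ratio at \<open>h\<close> is \<open>K\<close> to the power
  \<open>2 \<theta> \<rho> - \<rho>\<^sup>2 - \<beta>\<close>, and the noise density is \<open>K\<close> to the power \<open>- \<theta>\<^sup>2\<close>, up to lower order.\<close>

lemma above_boundary:
  assumes \<beta>: "1 / 2 < \<beta>" "\<beta> < 1" and \<rho>: "0 \<le> \<rho>" "detection_boundary \<beta> < \<rho>\<^sup>2"
  obtains \<theta> where "0 \<le> \<theta>" "0 < 2 * \<theta> * \<rho> - \<rho>\<^sup>2"
    "0 < 1 - \<theta>\<^sup>2 + (2 * \<theta> * \<rho> - \<rho>\<^sup>2 - \<beta>)" "0 < 1 - \<theta>\<^sup>2 + 2 * (2 * \<theta> * \<rho> - \<rho>\<^sup>2 - \<beta>)"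
proof -
  define u where "u = sqrt (1 - \<beta>)"
  have u: "\<beta> = 1 - u\<^sup>2" "0 < u" "u < 1"
    using \<beta> by (auto simp: u_def)
  show ?thesis
  proof (cases "\<rho> \<le> 1 - u")
    case True
    then have "\<rho>\<^sup>2 \<le> (1 - u)\<^sup>2"
      using \<rho> by (intro power_mono) auto
    \<comment> \<open>The second branch of the boundary would be at least \<rho>^2, so the first one
      applies.\<close>
    then have "\<beta> < 3 / 4" and b: "\<beta> - 1 / 2 < \<rho>\<^sup>2"
      using \<rho>(2) by (auto simp: detection_boundary_def u_def split: if_splits)
    have "(1 / 2)\<^sup>2 < u\<^sup>2"
      using \<open>\<beta> < 3 / 4\<close> u(1) by (simp add: power2_eq_square)
    then have "1 / 2 < u"
      using u by (intro power2_less_imp_less[of "1/2" u]) auto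
    then have "\<rho>\<^sup>2 < u\<^sup>2"
      using True \<rho> by (intro power_strict_mono) auto
    \<comment> \<open>The choice \<theta> = 2 \<rho> maximizes the last exponent, with value 1 + 2
      \<rho>^2 - 2 \<beta>; the other one becomes u^2 - \<rho>^2.\<close>
    then show ?thesis
      using b \<rho> \<beta> u(1) by (intro that[of "2 * \<rho>"]) (auto simp: power2_eq_square)
  next
    case False
    show ?thesis
    proof (cases "\<rho> \<le> 1")
      case True
      have "(1 - \<rho>)\<^sup>2 < u\<^sup>2"
        using False True by (intro power_strict_mono) auto
      then have "0 < 2 * \<rho> - \<rho>\<^sup>2 - \<beta>"
        unfolding u(1) by (simp add: power2_diff)
      \<comment> \<open>At \<theta> = 1 both exponents are positive multiples of 2 \<rho> - \<rho>^2
        - \<beta>.\<close>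
      then show ?thesis using \<beta> by (intro that[of 1]) auto
    next
      case False
      then have "1 < \<rho>\<^sup>2" by (simp add: power_one_over less_1_mult power2_eq_square)
      \<comment> \<open>For a strong signal the window starts at the mean itself. The exponents are
        then 1 - \<beta>, positive since \<beta> < 1, and 1 + \<rho>^2 - 2 \<beta>.\<close>
      then show ?thesis
        using \<beta> False by (intro that[of \<rho>]) (auto simp: power2_eq_square)
    qed
  qed
qed

section \<open>Asymptotics of the Hellinger distance on both sides of the boundary\<close>

lemma filterlim_sqrt_2_ln: "filterlim (\<lambda>K. sqrt (2 * ln (real K))) at_top sequentially"
  by real_asymp

lemma filterlim_exp_quadratic:
  assumes "0 < (c::real)" "0 < C"
  shows "filterlim (\<lambda>x. C * exp (c * x\<^sup>2 / 2 - \<theta> * x - 1 / 2)) at_top at_top"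
  using assms by real_asymp

lemma tendsto_exp_quadratic:
  assumes "(c::real) < 0"
  shows "((\<lambda>x. exp (c * x\<^sup>2 / 2)) \<longlongrightarrow> 0) at_top"
  using assms by real_asymp

lemma eps_star_bounds:
  assumes "0 \<le> \<beta>" "1 \<le> K"
  shows "0 \<le> eps_star \<beta> K" "eps_star \<beta> K \<le> 1"
proof -
  have "real K powr (- \<beta>) \<le> real K powr 0"
    using assms by (intro powr_mono) auto
  then show "0 \<le> eps_star \<beta> K" "eps_star \<beta> K \<le> 1"
    using assms by (auto simp: eps_star_def)
qed

lemma affinity_bounds:
  assumes "0 \<le> \<epsilon>" "\<epsilon> \<le> 1"
  shows "0 \<le> affinity \<epsilon> \<mu>" "affinity \<epsilon> \<mu> \<le> 1"
proof -
  have "2 * (1 - affinity \<epsilon> \<mu>) = (\<integral>z. (sqrt (lr_mix \<epsilon> \<mu> z) - 1)\<^sup>2 \<partial>std_normal)"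
    unfolding affinity_def using assms
    by (intro integral_sqrt_density(1) prob_space_normal lr_mix_nonneg prob_space_lr_mix) auto
  then have "0 \<le> 2 * (1 - affinity \<epsilon> \<mu>)"
    by (simp only: integral_nonneg_AE zero_le_power2 AE_I2)
  then show "affinity \<epsilon> \<mu> \<le> 1" by simp
  show "0 \<le> affinity \<epsilon> \<mu>"
    unfolding affinity_def using assms by (intro integral_nonneg_AE) (auto simp: lr_mix_nonneg)
qed

lemma exp_sqrt_2_ln:
  fixes K :: nat
  assumes "1 \<le> K" and x: "x = sqrt (2 * ln (real K))"
  shows "0 \<le> x" "real K = exp (x\<^sup>2 / 2)" "eps_star \<beta> K = exp (- \<beta> * x\<^sup>2 / 2)"
  using assms by (auto simp: eps_star_def powr_def)

text \<open>In terms of x = sqrt (2 ln K) one has K = exp (x^2 / 2), so with all parameters of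
  \<open>affinity_ge\<close> proportional to x each term of the bound is a fixed power of K. These
  powers are \<open>c\<^sub>1\<close> to \<open>c\<^sub>4\<close>, all negative.\<close>

lemma affinity_below_boundary:
  assumes \<beta>: "1 / 2 < \<beta>" "\<beta> \<le> 1" and \<rho>: "0 \<le> \<rho>" "\<rho>\<^sup>2 < detection_boundary \<beta>"
  shows "(\<lambda>K. real K * (1 - affinity (eps_star \<beta> K) (\<rho> * sqrt (2 * ln (real K))))) \<longlonglongrightarrow> 0"
proof -
  \<comment> \<open>This minimizes (2 \<rho> - k)^2 + 2 k over k >= 0, that is, the exponent of the
    truncated second moment.\<close>
  define \<kappa> where "\<kappa> = max 0 (2 * \<rho> - 1)"
  define c\<^sub>1 c\<^sub>2 c\<^sub>3 c\<^sub>4 where "c\<^sub>1 = 1 - 2 * \<beta>" and "c\<^sub>2 = 1 - 2 * \<beta> + (2 * \<rho> - \<kappa>)\<^sup>2 - 2 * \<rho>\<^sup>2 + 2 * \<kappa>"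
    and "c\<^sub>3 = 2 * \<rho> - \<rho>\<^sup>2 - \<beta>" and "c\<^sub>4 = - \<beta>"
  note c_defs = c\<^sub>1_def c\<^sub>2_def c\<^sub>3_def c\<^sub>4_def
  have c: "c\<^sub>1 < 0" "c\<^sub>2 < 0" "c\<^sub>3 < 0" "c\<^sub>4 < 0" and "\<rho> < 1"
    using below_boundary[OF \<beta> \<rho>] \<beta> by (simp_all add: c_defs \<kappa>_def)
  define g where "g x = exp (c\<^sub>1 * x\<^sup>2 / 2) + exp (c\<^sub>2 * x\<^sup>2 / 2) + exp (c\<^sub>3 * x\<^sup>2 / 2) + exp (c\<^sub>4 * x\<^sup>2 / 2)" for x :: real
  have "(g \<longlongrightarrow> 0 + 0 + 0 + 0) at_top"
    unfolding g_def by (intro tendsto_add tendsto_exp_quadratic c)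
  then have lim: "(\<lambda>K. g (sqrt (2 * ln (real K)))) \<longlonglongrightarrow> 0"
    using filterlim_compose[OF _ filterlim_sqrt_2_ln] by simp
  show ?thesis
  proof (rule tendsto_sandwich[OF _ _ tendsto_const lim])
    show "\<forall>\<^sub>F K in sequentially. 0 \<le> real K * (1 - affinity (eps_star \<beta> K) (\<rho> * sqrt (2 * ln (real K))))"
      using eventually_ge_at_top[of 1]
    proof eventually_elim
      case (elim K)
      show ?case
        using affinity_bounds(2)[OF eps_star_bounds[OF _ elim]] \<beta> by (intro mult_nonneg_nonneg) auto
    qed
    show "\<forall>\<^sub>F K in sequentially. real K * (1 - affinity (eps_star \<beta> K) (\<rho> * sqrt (2 * ln (real K)))) \<le> g (sqrt (2 * ln (real K)))"
      using eventually_ge_at_top[of 1]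
    proof eventually_elim
      case (elim K)
      define x where "x = sqrt (2 * ln (real K))"
      note x = exp_sqrt_2_ln[OF elim x_def]
      let ?\<epsilon> = "exp (- \<beta> * x\<^sup>2 / 2)" and ?\<mu> = "\<rho> * x"
      have \<epsilon>: "0 \<le> ?\<epsilon>" "?\<epsilon> \<le> 1"
        using \<beta> by auto
      \<comment> \<open>The cut is at h = x, the order of the largest of K noise variables. The
        parameters \<open>l\<^sub>1 = (1 - \<rho>) * x\<close> and \<open>l\<^sub>2 = x\<close>
        minimize their exponents.\<close>
      have "2 * (1 - affinity ?\<epsilon> ?\<mu>) \<le> ?\<epsilon>\<^sup>2 * (1 + exp ((2 * ?\<mu> - \<kappa> * x)\<^sup>2 / 2 + (\<kappa> * x * x - ?\<mu>\<^sup>2)))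
         + ?\<epsilon> * (exp ((?\<mu> + (1 - \<rho>) * x)\<^sup>2 / 2 + (- ((1 - \<rho>) * x) * x - ?\<mu>\<^sup>2 / 2)) + exp (x\<^sup>2 / 2 + (- x * x)))"
        using x(1) \<open>\<rho> < 1\<close> by (intro affinity_ge \<epsilon>) (auto simp: \<kappa>_def)
      then have "exp (x\<^sup>2 / 2) * (2 * (1 - affinity ?\<epsilon> ?\<mu>)) \<le> exp (x\<^sup>2 / 2) * (?\<epsilon>\<^sup>2 * (1 + exp ((2 * ?\<mu> - \<kappa> * x)\<^sup>2 / 2 + (\<kappa> * x * x - ?\<mu>\<^sup>2)))
         + ?\<epsilon> * (exp ((?\<mu> + (1 - \<rho>) * x)\<^sup>2 / 2 + (- ((1 - \<rho>) * x) * x - ?\<mu>\<^sup>2 / 2)) + exp (x\<^sup>2 / 2 + (- x * x))))"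
        by (intro mult_left_mono) auto
      also have "\<dots> = g x"
      proof -
        have "exp (x\<^sup>2 / 2) * ?\<epsilon>\<^sup>2 = exp (c\<^sub>1 * x\<^sup>2 / 2)"
          by (simp add: c_defs flip: exp_add exp_double) (simp add: field_simps)
        moreover have "exp (x\<^sup>2 / 2) * (?\<epsilon>\<^sup>2 * exp ((2 * ?\<mu> - \<kappa> * x)\<^sup>2 / 2 + (\<kappa> * x * x - ?\<mu>\<^sup>2))) = exp (c\<^sub>2 * x\<^sup>2 / 2)"
          by (simp add: c_defs flip: exp_add exp_double) (simp add: field_simps power2_eq_square)
        moreover have "exp (x\<^sup>2 / 2) * (?\<epsilon> * exp ((?\<mu> + (1 - \<rho>) * x)\<^sup>2 / 2 + (- ((1 - \<rho>) * x) * x - ?\<mu>\<^sup>2 / 2))) = exp (c\<^sub>3 * x\<^sup>2 / 2)"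
          by (simp add: c_defs flip: exp_add exp_double) (simp add: field_simps power2_eq_square)
        moreover have "exp (x\<^sup>2 / 2) * (?\<epsilon> * exp (x\<^sup>2 / 2 + (- x * x))) = exp (c\<^sub>4 * x\<^sup>2 / 2)"
          by (simp add: c_defs flip: exp_add exp_double) (simp add: field_simps power2_eq_square)
        ultimately show ?thesis
          unfolding g_def by (simp only: distrib_left mult_1_right add.assoc)
      qed
      finally have "exp (x\<^sup>2 / 2) * (2 * (1 - affinity ?\<epsilon> ?\<mu>)) \<le> g x" .
      moreover have "0 \<le> exp (x\<^sup>2 / 2) * (1 - affinity ?\<epsilon> ?\<mu>)"
        using affinity_bounds[OF \<epsilon>] by simp
      ultimately show ?case
        unfolding x_def[symmetric] unfolding x(2,3) by linarith
    qed
  qed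
qed

text \<open>Apply \<open>affinity_le\<close> at h = \<theta> x. Depending on which of y and y^2 is
  smaller, K times the bound has leading exponent 1 - \<theta>^2 + e or 1 - \<theta>^2 + 2 e, both
  positive. The shift from h to h + 1 costs only a factor exp (- \<theta> x - 1/2), which is of
  lower order.\<close>

lemma affinity_above_boundary:
  assumes \<beta>: "1 / 2 < \<beta>" "\<beta> < 1" and \<rho>: "0 \<le> \<rho>" "detection_boundary \<beta> < \<rho>\<^sup>2"
  shows "filterlim (\<lambda>K. real K * (1 - affinity (eps_star \<beta> K) (\<rho> * sqrt (2 * ln (real K))))) at_top sequentially"
proof -
  obtain \<theta> where \<theta>: "0 \<le> \<theta>" "0 < 2 * \<theta> * \<rho> - \<rho>\<^sup>2"
    "0 < 1 - \<theta>\<^sup>2 + (2 * \<theta> * \<rho> - \<rho>\<^sup>2 - \<beta>)" "0 < 1 - \<theta>\<^sup>2 + 2 * (2 * \<theta> * \<rho> - \<rho>\<^sup>2 - \<beta>)"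
    using above_boundary[OF \<beta> \<rho>] by blast
  \<comment> \<open>The likelihood ratio of the signal at h is K to the power \<open>d\<close>, its
    product with the weight of the signal is K to the power \<open>e\<close>, and \<open>c\<close>
    is the worse of the two final exponents.\<close>
  define d e c where "d = 2 * \<theta> * \<rho> - \<rho>\<^sup>2" and "e = d - \<beta>" and "c = min (1 - \<theta>\<^sup>2 + e) (1 - \<theta>\<^sup>2 + 2 * e)"
  have d: "0 < d" and c: "0 < c" "c \<le> 1 - \<theta>\<^sup>2 + e" "c \<le> 1 - \<theta>\<^sup>2 + 2 * e"
    using \<theta> by (auto simp: c_def e_def d_def)
  \<comment> \<open>Here 72 = 9 * 4 * 2: the 9 of \<open>affinity_le\<close>, the 4 lost by the
    halving in \<open>y\<close> when it is squared, and the 2 in front of 1 - A.\<close>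
  define C where "C = 1 / (72 * sqrt (2 * pi))"
  have "0 < C" by (simp add: C_def)
  define g where "g x = C * exp (c * x\<^sup>2 / 2 - \<theta> * x - 1 / 2)" for x
  have lim: "filterlim (\<lambda>K. g (sqrt (2 * ln (real K)))) at_top sequentially"
    unfolding g_def
    by (rule filterlim_compose[OF filterlim_exp_quadratic[OF c(1) \<open>0 < C\<close>] filterlim_sqrt_2_ln])
  \<comment> \<open>A likelihood ratio of at least 2 stays above half its value after 1 is
    subtracted; this is the 1/2 in the definition of \<open>y\<close>.\<close>
  have "\<forall>\<^sub>F x in at_top. 2 \<le> exp (d * x\<^sup>2 / 2)"
    using filterlim_exp_quadratic[OF d zero_less_one, of 0]
    by (auto simp: filterlim_at_top elim!: allE[of _ "2 :: real"] elim!: eventually_mono intro: order_trans)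
  then have ev: "\<forall>\<^sub>F K in sequentially. 2 \<le> exp (d * (sqrt (2 * ln (real K)))\<^sup>2 / 2)"
    using filterlim_sqrt_2_ln unfolding filterlim_iff by blast
  show ?thesis
  proof (rule filterlim_at_top_mono[OF lim])
    show "\<forall>\<^sub>F K in sequentially. g (sqrt (2 * ln (real K))) \<le> real K * (1 - affinity (eps_star \<beta> K) (\<rho> * sqrt (2 * ln (real K))))"
      using eventually_ge_at_top[of 1] ev
    proof eventually_elim
      case (elim K)
      define x where "x = sqrt (2 * ln (real K))"
      note x = exp_sqrt_2_ln[OF elim(1) x_def]
      let ?\<epsilon> = "exp (- \<beta> * x\<^sup>2 / 2)" and ?\<mu> = "\<rho> * x"
      define y where "y = exp (e * x\<^sup>2 / 2) / 2"
      have \<epsilon>: "0 \<le> ?\<epsilon>" "?\<epsilon> \<le> 1"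
        using \<beta> by auto
      have "y = ?\<epsilon> * (exp (d * x\<^sup>2 / 2) / 2)"
        by (simp add: y_def e_def field_simps flip: exp_add)
      also have "\<dots> \<le> ?\<epsilon> * (exp (d * x\<^sup>2 / 2) - 1)"
        using elim(2) by (intro mult_left_mono) (auto simp flip: x_def)
      also have "d * x\<^sup>2 / 2 = ?\<mu> * (\<theta> * x) - ?\<mu>\<^sup>2 / 2"
        by (simp add: d_def field_simps power2_eq_square)
      finally have y: "min y (y\<^sup>2) / 9 * std_normal_density (\<theta> * x + 1) \<le> 2 * (1 - affinity ?\<epsilon> ?\<mu>)"
        using x(1) \<rho>(1) \<theta>(1) by (intro affinity_le \<epsilon>) (auto simp: y_def)
      have cx: "c * x\<^sup>2 \<le> (1 - \<theta>\<^sup>2 + e) * x\<^sup>2" "c * x\<^sup>2 \<le> (1 - \<theta>\<^sup>2 + 2 * e) * x\<^sup>2"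
        using c by (auto intro!: mult_right_mono)
      have "exp (c * x\<^sup>2 / 2 - \<theta> * x - 1 / 2) \<le> exp (x\<^sup>2 / 2 - (\<theta> * x + 1)\<^sup>2 / 2 + e * x\<^sup>2 / 2)"
        using cx(1) by (simp add: field_simps power2_eq_square)
      also have "\<dots> = 2 * (exp (x\<^sup>2 / 2) * exp (- (\<theta> * x + 1)\<^sup>2 / 2) * y)"
        by (simp add: y_def flip: exp_add)
      also have "\<dots> \<le> 4 * (exp (x\<^sup>2 / 2) * exp (- (\<theta> * x + 1)\<^sup>2 / 2) * y)"
        by (intro mult_right_mono) (auto simp: y_def)
      finally have 1: "exp (c * x\<^sup>2 / 2 - \<theta> * x - 1 / 2) \<le> 4 * (exp (x\<^sup>2 / 2) * exp (- (\<theta> * x + 1)\<^sup>2 / 2) * y)" .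
      have "exp (c * x\<^sup>2 / 2 - \<theta> * x - 1 / 2) \<le> exp (x\<^sup>2 / 2 - (\<theta> * x + 1)\<^sup>2 / 2 + 2 * (e * x\<^sup>2 / 2))"
        using cx(2) by (simp add: field_simps power2_eq_square)
      also have "\<dots> = 4 * (exp (x\<^sup>2 / 2) * exp (- (\<theta> * x + 1)\<^sup>2 / 2) * y\<^sup>2)"
        by (simp add: y_def power_divide flip: exp_add exp_double)
      finally have 2: "exp (c * x\<^sup>2 / 2 - \<theta> * x - 1 / 2) \<le> 4 * (exp (x\<^sup>2 / 2) * exp (- (\<theta> * x + 1)\<^sup>2 / 2) * y\<^sup>2)" .
      have "exp (c * x\<^sup>2 / 2 - \<theta> * x - 1 / 2) \<le> 4 * (exp (x\<^sup>2 / 2) * exp (- (\<theta> * x + 1)\<^sup>2 / 2) * min y (y\<^sup>2))"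
        using 1 2 by (simp add: min_def)
      then have "g x \<le> C * (4 * (exp (x\<^sup>2 / 2) * exp (- (\<theta> * x + 1)\<^sup>2 / 2) * min y (y\<^sup>2)))"
        unfolding g_def using \<open>0 < C\<close> by (intro mult_left_mono) auto
      also have "\<dots> = exp (x\<^sup>2 / 2) * (min y (y\<^sup>2) / 9 * std_normal_density (\<theta> * x + 1) / 2)"
        by (simp add: C_def std_normal_density_def)
      also have "\<dots> \<le> exp (x\<^sup>2 / 2) * (1 - affinity ?\<epsilon> ?\<mu>)"
        using y by (intro mult_left_mono) auto
      finally show ?case
        unfolding x_def[symmetric] unfolding x(2,3) .
    qed
  qed
qed

section \<open>Tail bounds for the process and the stopping time\<close>

lemma measure_e_proc:
  assumes K: "1 \<le> K" "1 \<le> s" and \<epsilon>: "0 \<le> \<epsilon>" "\<epsilon> \<le> 1" and S: "S \<in> sets borel"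
  shows "{\<omega> \<in> space (array_law K \<epsilon> \<delta>). e_proc K \<epsilon> \<delta> s \<omega> \<in> S} \<in> sets (array_law K \<epsilon> \<delta>)"
    and "measure (array_law K \<epsilon> \<delta>) {\<omega> \<in> space (array_law K \<epsilon> \<delta>). e_proc K \<epsilon> \<delta> s \<omega> \<in> S}
    = measure (density (PiM {1..K} (\<lambda>_. std_normal)) (\<lambda>w. \<Prod>i\<in>{1..K}. ennreal (lr_mix \<epsilon> (sqrt (real s) * \<delta>) (w i))))
        {w \<in> space (PiM {1..K} (\<lambda>_. std_normal)). (\<Prod>i\<in>{1..K}. lr_mix \<epsilon> (sqrt (real s) * \<delta>) (w i)) \<in> S}"
proof -
  note [measurable] = S
  let ?B = "PiM {1..K} (\<lambda>_. borel) :: (nat \<Rightarrow> real) measure"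
  let ?S = "{w \<in> space ?B. (\<Prod>i\<in>{1..K}. lr_mix \<epsilon> (sqrt (real s) * \<delta>) (w i)) \<in> S}"
  have m: "row_stat K s \<in> array_law K \<epsilon> \<delta> \<rightarrow>\<^sub>M ?B"
    unfolding measurable_cong_sets[OF sets_array_law refl] by (rule measurable_row_stat)
  have "?S \<in> sets ?B" by measurable
  \<comment> \<open>The event depends on the row statistics only, so its probability can be computed
    under their law.\<close>
  have eq: "{\<omega> \<in> space (array_law K \<epsilon> \<delta>). e_proc K \<epsilon> \<delta> s \<omega> \<in> S} = row_stat K s -` ?S \<inter> space (array_law K \<epsilon> \<delta>)"
    using measurable_space[OF m] by (auto simp: e_proc_row_stat[OF K(2)])
  show "{\<omega> \<in> space (array_law K \<epsilon> \<delta>). e_proc K \<epsilon> \<delta> s \<omega> \<in> S} \<in> sets (array_law K \<epsilon> \<delta>)"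
    unfolding eq by (rule measurable_sets[OF m]) fact
  have "measure (array_law K \<epsilon> \<delta>) {\<omega> \<in> space (array_law K \<epsilon> \<delta>). e_proc K \<epsilon> \<delta> s \<omega> \<in> S}
      = measure (distr (array_law K \<epsilon> \<delta>) ?B (row_stat K s)) ?S"
    unfolding eq by (rule measure_distr[OF m, symmetric]) fact
  then show "measure (array_law K \<epsilon> \<delta>) {\<omega> \<in> space (array_law K \<epsilon> \<delta>). e_proc K \<epsilon> \<delta> s \<omega> \<in> S}
    = measure (density (PiM {1..K} (\<lambda>_. std_normal)) (\<lambda>w. \<Prod>i\<in>{1..K}. ennreal (lr_mix \<epsilon> (sqrt (real s) * \<delta>) (w i))))
        {w \<in> space (PiM {1..K} (\<lambda>_. std_normal)). (\<Prod>i\<in>{1..K}. lr_mix \<epsilon> (sqrt (real s) * \<delta>) (w i)) \<in> S}"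
    unfolding distr_row_stat[OF K \<epsilon>] by (simp add: space_PiM)
qed

lemma prob_e_proc_ge:
  assumes K: "1 \<le> K" "1 \<le> s" and \<epsilon>: "0 \<le> \<epsilon>" "\<epsilon> \<le> 1" and c: "1 < c"
  shows "\<P>(\<omega> in array_law K \<epsilon> \<delta>. c \<le> e_proc K \<epsilon> \<delta> s \<omega>)
    \<le> (sqrt c / (sqrt c - 1))\<^sup>2 * (2 * (real K * (1 - affinity \<epsilon> (sqrt (real s) * \<delta>))))"
proof -
  let ?A = "affinity \<epsilon> (sqrt (real s) * \<delta>)"
  have "\<P>(\<omega> in array_law K \<epsilon> \<delta>. c \<le> e_proc K \<epsilon> \<delta> s \<omega>) \<le> (sqrt c / (sqrt c - 1))\<^sup>2 * (2 - 2 * ?A ^ card {1..K})"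
    using measure_e_proc(2)[OF K \<epsilon>, of "{c..}" \<delta>]
      prob_product_density_ge[OF prob_space_normal _ lr_mix_nonneg[OF \<epsilon>, of "sqrt (real s) * \<delta>"]
        prob_space_lr_mix[OF \<epsilon>] finite_atLeastAtMost[of 1 K] c]
    by (simp add: affinity_def)
  \<comment> \<open>Bernoulli's inequality: 1 - A^K <= K (1 - A).\<close>
  also have "\<dots> \<le> (sqrt c / (sqrt c - 1))\<^sup>2 * (2 * (real K * (1 - ?A)))"
    using Bernoulli_inequality[of "?A - 1" K] affinity_bounds[OF \<epsilon>, of "sqrt (real s) * \<delta>"]
    by (intro mult_left_mono) (auto simp: algebra_simps)
  finally show ?thesis .
qed

lemma prob_e_proc_less:
  assumes K: "1 \<le> K" "1 \<le> s" and \<epsilon>: "0 \<le> \<epsilon>" "\<epsilon> \<le> 1" and c: "0 < c"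
  shows "\<P>(\<omega> in array_law K \<epsilon> \<delta>. e_proc K \<epsilon> \<delta> s \<omega> < c)
    \<le> sqrt c * exp (- (real K * (1 - affinity \<epsilon> (sqrt (real s) * \<delta>))))"
proof -
  let ?A = "affinity \<epsilon> (sqrt (real s) * \<delta>)"
  have "\<P>(\<omega> in array_law K \<epsilon> \<delta>. e_proc K \<epsilon> \<delta> s \<omega> < c) \<le> sqrt c * ?A ^ card {1..K}"
    using measure_e_proc(2)[OF K \<epsilon>, of "{..<c}" \<delta>]
      prob_product_density_less[OF prob_space_normal _ lr_mix_nonneg[OF \<epsilon>, of "sqrt (real s) * \<delta>"]
        prob_space_lr_mix[OF \<epsilon>] finite_atLeastAtMost[of 1 K] c]
    by (simp add: affinity_def)
  \<comment> \<open>From A <= exp (A - 1) and A >= 0.\<close>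
  also have "\<dots> \<le> sqrt c * exp (- (1 - ?A)) ^ K"
    using affinity_bounds(1)[OF \<epsilon>, of "sqrt (real s) * \<delta>"] exp_ge_add_one_self[of "?A - 1"] c
    by (auto intro!: mult_left_mono power_mono)
  also have "exp (- (1 - ?A)) ^ K = exp (- (real K * (1 - ?A)))"
    by (simp add: algebra_simps flip: exp_of_nat_mult)
  finally show ?thesis .
qed

text \<open>A nonempty infimum in \<open>enat\<close> is attained, and the empty one is infinite,
  hence not below \<open>enat t\<close>. Detection by time \<open>t\<close> is thus a finite union
  of threshold events.\<close>

lemma stop_time_le_iff:
  "stop_time K \<epsilon> \<delta> \<alpha> \<omega> \<le> enat t \<longleftrightarrow> (\<exists>s\<in>{1..t}. 1 / \<alpha> \<le> e_proc K \<epsilon> \<delta> s \<omega>)"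
proof
  let ?S = "{s. 1 \<le> s \<and> 1 / \<alpha> \<le> e_proc K \<epsilon> \<delta> s \<omega>}"
  assume le: "stop_time K \<epsilon> \<delta> \<alpha> \<omega> \<le> enat t"
  have "enat ` ?S \<noteq> {}"
  proof
    assume empty: "enat ` ?S = {}"
    show False using le unfolding stop_time_def empty by (simp add: top_enat_def)
  qed
  then obtain k where "k \<in> enat ` ?S" by blast
  then have "Inf (enat ` ?S) \<in> enat ` ?S"
    by (rule wellorder_InfI)
  with le show "\<exists>s\<in>{1..t}. 1 / \<alpha> \<le> e_proc K \<epsilon> \<delta> s \<omega>"
    by (auto simp: stop_time_def)
next
  assume "\<exists>s\<in>{1..t}. 1 / \<alpha> \<le> e_proc K \<epsilon> \<delta> s \<omega>"
  then obtain s where s: "s \<in> {1..t}" "1 / \<alpha> \<le> e_proc K \<epsilon> \<delta> s \<omega>" by blast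
  then have "stop_time K \<epsilon> \<delta> \<alpha> \<omega> \<le> enat s"
    unfolding stop_time_def by (intro INF_lower) auto
  also have "\<dots> \<le> enat t" using s by simp
  finally show "stop_time K \<epsilon> \<delta> \<alpha> \<omega> \<le> enat t" .
qed

text \<open>This identifies \<rho> as sqrt (s / T), so that comparing \<rho>^2 with the boundary
  compares s with T times the boundary.\<close>

lemma mean_shift_star:
  "sqrt (real s) * delta_star T K = sqrt (real s / T) * sqrt (2 * ln (real K))"
  unfolding delta_star_def by (simp flip: real_sqrt_mult)

theorem theorem2p3:
  fixes t :: nat and \<beta> T \<alpha> :: real
  assumes "1 \<le> t"
    and "1 / 2 < \<beta>" and "\<beta> \<le> 1"
    and "0 < T"
    and "0 < \<alpha>" and "\<alpha> < 1"
  shows "(real t < T * detection_boundary \<beta> \<longrightarrow>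
            (\<lambda>K. detect_prob \<beta> T \<alpha> t K) \<longlonglongrightarrow> 0) \<and>
         (T * detection_boundary \<beta> < real t \<and> \<beta> < 1 \<longrightarrow>
            (\<lambda>K. detect_prob \<beta> T \<alpha> t K) \<longlonglongrightarrow> 1)"
proof (intro conjI impI)
  define E where "E K s = {\<omega> \<in> space (array_law K (eps_star \<beta> K) (delta_star T K)).
      1 / \<alpha> \<le> e_proc K (eps_star \<beta> K) (delta_star T K) s \<omega>}" for K s
  define A where "A K s = real K * (1 - affinity (eps_star \<beta> K) (sqrt (real s / T) * sqrt (2 * ln (real K))))" for K s
  have \<epsilon>: "0 \<le> eps_star \<beta> K" "eps_star \<beta> K \<le> 1" if "1 \<le> K" for K
    using that assms eps_star_bounds[of \<beta> K] by auto
  have sets_E: "E K s \<in> sets (array_law K (eps_star \<beta> K) (delta_star T K))" if "1 \<le> K" "1 \<le> s" for K s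
    using measure_e_proc(1)[OF that \<epsilon>[OF that(1)], of "{1 / \<alpha>..}"] by (simp add: E_def)
  have detect: "detect_prob \<beta> T \<alpha> t K = measure (array_law K (eps_star \<beta> K) (delta_star T K)) (\<Union>s\<in>{1..t}. E K s)" for K
    unfolding detect_prob_def stop_time_le_iff E_def by (intro arg_cong[where f="measure _"]) auto
  have \<alpha>: "1 < 1 / \<alpha>" using assms by simp
  {
    assume t: "real t < T * detection_boundary \<beta>"
    define C where "C = (sqrt (1 / \<alpha>) / (sqrt (1 / \<alpha>) - 1))\<^sup>2"
    \<comment> \<open>Every time up to \<open>t\<close> lies below the boundary as well, so a union
      bound over these finitely many times suffices.\<close>
    have "(\<lambda>K. A K s) \<longlonglongrightarrow> 0" if s: "s \<in> {1..t}" for s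
    proof -
      have "real s < T * detection_boundary \<beta>"
        using s t by (meson atLeastAtMost_iff le_less_trans of_nat_mono)
      then have "real s / T < detection_boundary \<beta>"
        using assms by (simp add: field_simps)
      then show ?thesis
        unfolding A_def using assms by (intro affinity_below_boundary) auto
    qed
    then have "(\<lambda>K. \<Sum>s\<in>{1..t}. C * (2 * A K s)) \<longlonglongrightarrow> (\<Sum>s\<in>{1..t}. C * (2 * 0))"
      by (intro tendsto_sum tendsto_mult tendsto_const)
    then have lim: "(\<lambda>K. \<Sum>s\<in>{1..t}. C * (2 * A K s)) \<longlonglongrightarrow> 0" by simp
    show "(\<lambda>K. detect_prob \<beta> T \<alpha> t K) \<longlonglongrightarrow> 0"
    proof (rule tendsto_sandwich[OF _ _ tendsto_const lim])
      show "\<forall>\<^sub>F K in sequentially. 0 \<le> detect_prob \<beta> T \<alpha> t K"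
        by (simp add: detect_prob_def)
      show "\<forall>\<^sub>F K in sequentially. detect_prob \<beta> T \<alpha> t K \<le> (\<Sum>s\<in>{1..t}. C * (2 * A K s))"
        using eventually_ge_at_top[of 1]
      proof eventually_elim
        case (elim K)
        interpret prob_space "array_law K (eps_star \<beta> K) (delta_star T K)"
          by (rule prob_space_array_law)
        have "detect_prob \<beta> T \<alpha> t K \<le> (\<Sum>s\<in>{1..t}. prob (E K s))"
          unfolding detect using sets_E elim by (intro finite_measure_subadditive_finite) auto
        also have "\<dots> \<le> (\<Sum>s\<in>{1..t}. C * (2 * A K s))"
          using prob_e_proc_ge[OF elim _ \<epsilon>[OF elim] \<alpha>, of _ "delta_star T K"] assms
          by (intro sum_mono) (simp add: E_def A_def C_def mean_shift_star)
        finally show ?case .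
      qed
    qed
  }
  {
    assume t: "T * detection_boundary \<beta> < real t \<and> \<beta> < 1"
    then have "detection_boundary \<beta> < real t / T"
      using assms by (simp add: field_simps)
    \<comment> \<open>Above the boundary time \<open>t\<close> alone is enough, because crossing the
      threshold at \<open>t\<close> already forces detection by then.\<close>
    then have "filterlim (\<lambda>K. A K t) at_top sequentially"
      unfolding A_def using assms t by (intro affinity_above_boundary) auto
    then have "(\<lambda>K. exp (- A K t)) \<longlonglongrightarrow> 0"
      by (intro filterlim_compose[OF exp_at_bot] filterlim_compose[OF filterlim_uminus_at_bot_at_top])
    then have "(\<lambda>K. 1 - sqrt (1 / \<alpha>) * exp (- A K t)) \<longlonglongrightarrow> 1 - sqrt (1 / \<alpha>) * 0"
      by (intro tendsto_intros)
    then have lim: "(\<lambda>K. 1 - sqrt (1 / \<alpha>) * exp (- A K t)) \<longlonglongrightarrow> 1" by simp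
    show "(\<lambda>K. detect_prob \<beta> T \<alpha> t K) \<longlonglongrightarrow> 1"
    proof (rule tendsto_sandwich[OF _ _ lim tendsto_const])
      show "\<forall>\<^sub>F K in sequentially. 1 - sqrt (1 / \<alpha>) * exp (- A K t) \<le> detect_prob \<beta> T \<alpha> t K"
        using eventually_ge_at_top[of 1]
      proof eventually_elim
        case (elim K)
        interpret prob_space "array_law K (eps_star \<beta> K) (delta_star T K)"
          by (rule prob_space_array_law)
        have "1 - prob (E K t) = prob (space (array_law K (eps_star \<beta> K) (delta_star T K)) - E K t)"
          using sets_E[OF elim assms(1)] by (rule prob_compl[symmetric])
        also have "\<dots> = \<P>(\<omega> in array_law K (eps_star \<beta> K) (delta_star T K). e_proc K (eps_star \<beta> K) (delta_star T K) t \<omega> < 1 / \<alpha>)"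
          by (intro arg_cong[where f=prob]) (auto simp: E_def)
        also have "\<dots> \<le> sqrt (1 / \<alpha>) * exp (- A K t)"
          unfolding A_def mean_shift_star[symmetric]
          using assms by (intro prob_e_proc_less elim \<epsilon>) auto
        finally have "1 - sqrt (1 / \<alpha>) * exp (- A K t) \<le> prob (E K t)" by simp
        also have "\<dots> \<le> detect_prob \<beta> T \<alpha> t K"
          unfolding detect using sets_E elim assms(1) by (intro finite_measure_mono) auto
        finally show ?case .
      qed
      show "\<forall>\<^sub>F K in sequentially. detect_prob \<beta> T \<alpha> t K \<le> 1"
        unfolding detect_prob_def by (intro always_eventually allI prob_space.prob_le_1 prob_space_array_law)
    qed
  }
qed

end
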